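(* Let $k$ be a number field or one of its completions, let $\mathbb{O}$ be an octonion algebra over $k$ and $G_k=\mathrm{Aut}_k(\mathbb{O})$ the associated algebraic group of type $G_2$. The isomorphism classes of simply connected $A_2$ subgroups embedding in $G_k$ are controlled by the structure of $\mathbb{O}$ at the real places of $k$, in the following sense. Let $H_k\subset G_k$ be a simply connected $A_2$ subgroup, with associated quadratic étale $k$-algebra $A\hookrightarrow\mathbb{O}$, and let $\nu$ be a real place of $k$, with completion $k_\nu$. \begin{itemize} \item If $\mathbb{O}$ is definite at $k_\nu$, then $A$ is imaginary at $\nu$ (the place $\nu$ ramifies in $A$) and the special unitary group $H_{k_\nu}$ is definite. \item If $\mathbb{O}$ is indefinite at $k_\nu$ and $A$ is imaginary at $\nu$, then the special unitary group $H_{k_\nu}$ is indefinite. \item If $\mathbb{O}$ is indefinite at $k_\nu$ and $A$ is real at $\nu$ (the place $\nu$ splits in $A$), then $H_{k_\nu}$ is split, that is, $H_{k_\nu}\simeq\mathrm{SL}_{3,k_\nu}$. \end{itemize}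
   Context: An octonion algebra $\mathbb{O}$ has a standard involution $\sigma$, norm form $N(u)=u\sigma(u)$ and bilinear form $(u,v)=\tfrac12(u\sigma(v)+v\sigma(u))$. $\mathbb{O}$ is definite (resp. indefinite, equivalently split) at a real place $\nu$ if its norm form over $k_\nu$ is definite (resp. indefinite, of signature $(4,4)$). A simply connected $A_2$ subgroup of $G_k$ is a closed $k$-subgroup that is semisimple simply connected of type $A_2$. Each such subgroup $H_k$ is the stabilizer in $G_k$ of an element $x\in\mathbb{O}$ perpendicular to $1$ with $N(x)\ne0$, and the associated quadratic étale algebra is $A=A_x=k\langle x\rangle\subset\mathbb{O}$. The orthogonal complement $A_x^\perp$ of $A_x$ in $\mathbb{O}$ is a rank-$3$ $A_x$-module by left multiplication, with $A_x$-valued Hermitian form $H(y,z)=\tfrac12(y,z)+\tfrac1{2x}(xy,z)$, and $H_k$ is the special unitary group $\mathrm{SU}_{A_x^\perp}$ of this Hermitian space. $A$ is imaginary at $\nu$ if $A\otimes_kk_\nu\simeq\mathbb{C}$ and real at $\nu$ if $A\otimes_kk_\nu\simeq k_\nu\times k_\nu$. When $A$ is imaginary at $\nu$, $H_{k_\nu}$ is called definite or indefinite according to whether the Hermitian form over $k_\nu$ is definite or indefinite. *)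

theory Defs
  imports "HOL-Analysis.Analysis" "HOL-Algebra.Solvable_Groups"
begin

section \<open>Number fields, their completions, and real places\<close>

definition is_number_field :: "'k::field_char_0 set \<Rightarrow> bool" where
  "is_number_field F \<longleftrightarrow>
     1 \<in> F \<and> (\<forall>a\<in>F. \<forall>b\<in>F. a - b \<in> F \<and> a * b \<in> F) \<and> (\<forall>a\<in>F. inverse a \<in> F) \<and>
     (\<exists>B. finite B \<and> F = module.span (\<lambda>q a. of_rat q * a) B)"

definition absolute_value :: "('k::field \<Rightarrow> real) \<Rightarrow> bool" where
  "absolute_value v \<longleftrightarrow>
     (\<forall>a. 0 \<le> v a) \<and> (\<forall>a. v a = 0 \<longleftrightarrow> a = 0) \<and>
     (\<forall>a b. v (a * b) = v a * v b) \<and> (\<forall>a b. v (a + b) \<le> v a + v b)"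

text \<open>The completion of a number field at a place is a field which is complete for an absolute
  value and contains the number field as a dense subfield on which that absolute value is
  nontrivial.\<close>

definition number_field_or_completion :: "'k::field_char_0 itself \<Rightarrow> bool" where
  "number_field_or_completion _ \<longleftrightarrow>
     is_number_field (UNIV :: 'k set) \<or>
     (\<exists>(F :: 'k set) v. is_number_field F \<and> absolute_value v \<and> (\<exists>a\<in>F. a \<noteq> 0 \<and> v a \<noteq> 1) \<and>
        Metric_space.mcomplete UNIV (\<lambda>a b. v (a - b)) \<and>
        (\<forall>a. \<forall>e>0. \<exists>b\<in>F. v (a - b) < e))"

text \<open>A real place of \<open>k\<close> is given by a field embedding \<open>\<nu> : k \<rightarrow> \<real>\<close>. Its image contains the
  rationals, hence is dense, so the completion of \<open>k\<close> at \<open>\<nu>\<close> is \<open>\<real>\<close> itself, viewed as an extension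
  of \<open>k\<close> through \<open>\<nu>\<close>. (A completion of a number field embeds in \<open>\<real>\<close> only if it is
  isomorphic to \<open>\<real>\<close>, and then in exactly one way.)\<close>

definition real_place :: "('k::field \<Rightarrow> real) \<Rightarrow> bool" where
  "real_place \<nu> \<longleftrightarrow> \<nu> 1 = 1 \<and> (\<forall>a b. \<nu> (a + b) = \<nu> a + \<nu> b) \<and> (\<forall>a b. \<nu> (a * b) = \<nu> a * \<nu> b)"


section \<open>Octonion algebras\<close>

text \<open>The bilinear form, normalised so that \<open>(u, u) = N u\<close>.\<close>

definition bform :: "('k::field^'n \<Rightarrow> 'k) \<Rightarrow> 'k^'n \<Rightarrow> 'k^'n \<Rightarrow> 'k" where
  "bform N u v = (N (u + v) - N u - N v) / 2"

text \<open>An octonion algebra is an 8-dimensional unital, not necessarily associative, algebra with a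
  nondegenerate multiplicative quadratic form. A basis has been chosen, so that the underlying
  vector space is \<open>k\<^sup>8\<close>; the multiplication \<open>m\<close>, the unit \<open>e\<close> and the norm \<open>N\<close> are arbitrary.
  (The unit and the norm are determined by the multiplication.)\<close>

definition octonion_algebra ::
  "('k::field_char_0^8 \<Rightarrow> 'k^8 \<Rightarrow> 'k^8) \<Rightarrow> 'k^8 \<Rightarrow> ('k^8 \<Rightarrow> 'k) \<Rightarrow> bool" where
  "octonion_algebra m e N \<longleftrightarrow>
     (\<forall>u. Vector_Spaces.linear (*s) (*s) (m u)) \<and>
     (\<forall>v. Vector_Spaces.linear (*s) (*s) (\<lambda>u. m u v)) \<and>
     (\<forall>u. m e u = u \<and> m u e = u) \<and>
     (\<forall>a u. N (a *s u) = a\<^sup>2 * N u) \<and>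
     (\<forall>u. Vector_Spaces.linear (*s) (*) (bform N u)) \<and>
     (\<forall>u. (\<forall>v. bform N u v = 0) \<longrightarrow> u = 0) \<and>
     (\<forall>u v. N (m u v) = N u * N v)"

definition oconj :: "'k::field^'n \<Rightarrow> ('k^'n \<Rightarrow> 'k) \<Rightarrow> 'k^'n \<Rightarrow> 'k^'n" where
  "oconj e N u = (2 * bform N u e) *s e - u"

definition oinverse :: "'k::field^'n \<Rightarrow> ('k^'n \<Rightarrow> 'k) \<Rightarrow> 'k^'n \<Rightarrow> 'k^'n" where
  "oinverse e N u = inverse (N u) *s oconj e N u"

definition generated_subalgebra ::
  "('k::field^'n \<Rightarrow> 'k^'n \<Rightarrow> 'k^'n) \<Rightarrow> 'k^'n \<Rightarrow> ('k^'n) set \<Rightarrow> ('k^'n) set" where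
  "generated_subalgebra m e S =
     \<Inter>{B. vec.subspace B \<and> e \<in> B \<and> S \<subseteq> B \<and> (\<forall>a\<in>B. \<forall>b\<in>B. m a b \<in> B)}"

text \<open>Extension of scalars along a field homomorphism \<open>h\<close>: of vectors, subspaces, bilinear
  products and quadratic forms on \<open>k\<^sup>n\<close>.\<close>

definition ext_vec :: "('k \<Rightarrow> 'l) \<Rightarrow> 'k^'n \<Rightarrow> 'l^'n" where
  "ext_vec h u = (\<chi> i. h (u $ i))"

definition ext_space :: "('k \<Rightarrow> 'l::field) \<Rightarrow> ('k^'n) set \<Rightarrow> ('l^'n) set" where
  "ext_space h A = vec.span (ext_vec h ` A)"

definition ext_mult ::
  "('k::field \<Rightarrow> 'l::field) \<Rightarrow> ('k^'n \<Rightarrow> 'k^'n \<Rightarrow> 'k^'n) \<Rightarrow> 'l^'n \<Rightarrow> 'l^'n \<Rightarrow> 'l^'n" where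
  "ext_mult h m u v =
     (\<Sum>i\<in>UNIV. \<Sum>j\<in>UNIV. (u $ i * v $ j) *s ext_vec h (m (axis i 1) (axis j 1)))"

definition ext_form :: "('k::field \<Rightarrow> 'l::field) \<Rightarrow> ('k^'n \<Rightarrow> 'k) \<Rightarrow> 'l^'n \<Rightarrow> 'l" where
  "ext_form h N u = (\<Sum>i\<in>UNIV. \<Sum>j\<in>UNIV. u $ i * u $ j * h (bform N (axis i 1) (axis j 1)))"

text \<open>Consistency: in an octonion algebra, \<open>u \<sigma>(u) = N(u)\<close>.\<close>

lemma octonion_norm_eq:
  assumes "octonion_algebra m e N"
  shows "m u (oconj e N u) = N u *s e"
proof -
  let ?B = "bform N"
  have linB: "Vector_Spaces.linear (*s) (*) (?B u)" for u
    using assms by (simp add: octonion_algebra_def)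
  have linr: "Vector_Spaces.linear (*s) (*s) (m u)" for u
    using assms by (simp add: octonion_algebra_def)
  have linl: "Vector_Spaces.linear (*s) (*s) (\<lambda>u. m u v)" for v
    using assms by (simp add: octonion_algebra_def)
  note lin_simps = Vector_Spaces.linear_iff
  have sym: "?B u v = ?B v u" for u v
    by (simp add: bform_def add.commute)
  have Badd: "?B u (v + w) = ?B u v + ?B u w" and Bscale: "?B u (c *s v) = c * ?B u v" for u v w c
    using linB by (auto simp: lin_simps)
  have Bdiff: "?B u (v - w) = ?B u v - ?B u w" for u v w
    using Badd[of u "v - w" w] by simp
  have Baddl: "?B (u + v) w = ?B u w + ?B v w" and Bscalel: "?B (c *s u) w = c * ?B u w"
    and Bdiffl: "?B (u - v) w = ?B u w - ?B v w" for u v w c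
    using Badd Bscale Bdiff sym by metis+
  have madd: "m u (v + w) = m u v + m u w" for u v w
    using linr by (auto simp: lin_simps)
  have maddl: "m (u + v) w = m u w + m v w" and mscalel: "m (c *s u) w = c *s m u w" for u v w c
    using linl by (auto simp: lin_simps)
  have mdiffl: "m (u - v) w = m u w - m v w" for u v w
    using maddl[of "u - v" v w] by simp
  have unit: "m e v = v" "m v e = v" for v
    using assms by (auto simp: octonion_algebra_def)
  have mult: "N (m v w) = N v * N w" for v w
    using assms by (simp add: octonion_algebra_def)
  have Nscale: "N (c *s v) = c\<^sup>2 * N v" for c v
    using assms by (simp add: octonion_algebra_def)
  have nondeg: "v = 0" if "\<And>w. ?B v w = 0" for v
    using assms that by (simp add: octonion_algebra_def)
  have Nadd: "N (v + w) = N v + N w + 2 * ?B v w" for v w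
    by (simp add: bform_def field_simps)
  have NB: "N v = ?B v v" for v
  proof -
    have "v + v = 2 *s v" by (metis mult_2 one_add_one vec.scale_left_distrib vec.scale_one)
    then have "N (v + v) = 4 * N v" by (simp add: Nscale)
    then have "?B v v = (4 * N v - N v - N v) / 2" by (simp only: bform_def)
    then show ?thesis by simp
  qed
  have p1: "?B (m v w) (m v z) = N v * ?B w z" for v w z
  proof -
    have "N (m v w + m v z) = N v * N (w + z)" by (simp only: mult flip: madd)
    then show ?thesis by (simp add: bform_def mult right_diff_distrib)
  qed
  have p2: "?B (m v z) (m w z) = ?B v w * N z" for v w z
  proof -
    have "N (m v z + m w z) = N (v + w) * N z" by (simp only: mult flip: maddl)
    then show ?thesis by (simp add: bform_def mult left_diff_distrib)
  qed
  have p3: "?B (m v w) z + ?B (m v z) w = 2 * ?B v e * ?B w z" for v w z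
  proof -
    have "?B (m v w) w + ?B (m v w) z + (?B (m v z) w + ?B (m v z) z)
        = ?B v e * (N w + N z + 2 * ?B w z)"
      using p2[of v "w + z" e] by (simp only: madd unit Badd Baddl Nadd add_ac)
    moreover have "?B (m v w) w = ?B v e * N w" "?B (m v z) z = ?B v e * N z"
      using p2[of v w e] p2[of v z e] by (simp_all only: unit)
    ultimately show ?thesis by (simp add: ring_distribs)
  qed
  have adj: "?B (m v w) z = ?B w (m (oconj e N v) z)" for v w z
  proof -
    have "?B w (m (oconj e N v) z) = 2 * ?B v e * ?B w z - ?B w (m v z)"
      by (simp only: oconj_def mdiffl mscalel unit Bdiff Bscale)
    then show ?thesis using p3[of v w z] sym[of "m v z" w] by (metis add_diff_cancel_right')
  qed
  have conj_conj: "N (oconj e N u) = N u"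
  proof (cases "N e = 1")
    case True
    then have "?B e e = 1" by (simp add: NB)
    then have "?B (oconj e N u) (oconj e N u) = ?B u u"
      unfolding oconj_def Bdiff Bdiffl Bscale Bscalel sym[of e u] by (simp add: algebra_simps)
    then show ?thesis by (simp only: NB)
  next
    case False
    have "N e * N e = N e" using mult[of e e] by (simp add: unit)
    then have "N e = 0" using False by simp
    then have "N v = 0" for v using mult[of v e] by (simp add: unit)
    then show ?thesis by simp
  qed
  have "?B (m u (oconj e N u) - N u *s e) z = 0" for z
  proof -
    have "?B (m (oconj e N u) e) (m (oconj e N u) z) = N (oconj e N u) * ?B e z" by (rule p1)
    then show ?thesis by (simp only: adj unit conj_conj Bdiffl Bscalel diff_self)
  qed
  then show ?thesis using nondeg by fastforce
qed


section \<open>Real quadratic and Hermitian forms, real quadratic algebras\<close>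

definition definite_form :: "(real^'n \<Rightarrow> real) \<Rightarrow> bool" where
  "definite_form N \<longleftrightarrow> (\<forall>u. u \<noteq> 0 \<longrightarrow> 0 < N u) \<or> (\<forall>u. u \<noteq> 0 \<longrightarrow> N u < 0)"

definition indefinite_form :: "(real^'n \<Rightarrow> real) \<Rightarrow> bool" where
  "indefinite_form N \<longleftrightarrow> (\<exists>u. 0 < N u) \<and> (\<exists>u. N u < 0)"

definition imaginary_algebra ::
  "(real^'n \<Rightarrow> real^'n \<Rightarrow> real^'n) \<Rightarrow> real^'n \<Rightarrow> (real^'n) set \<Rightarrow> bool" where
  "imaginary_algebra m e A \<longleftrightarrow>
     (\<exists>\<phi> :: real^'n \<Rightarrow> complex. bij_betw \<phi> A UNIV \<and> \<phi> e = 1 \<and>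
        (\<forall>a\<in>A. \<forall>b\<in>A. \<phi> (a + b) = \<phi> a + \<phi> b \<and> \<phi> (m a b) = \<phi> a * \<phi> b) \<and>
        (\<forall>r. \<forall>a\<in>A. \<phi> (r *s a) = complex_of_real r * \<phi> a))"

definition real_split_algebra ::
  "(real^'n \<Rightarrow> real^'n \<Rightarrow> real^'n) \<Rightarrow> real^'n \<Rightarrow> (real^'n) set \<Rightarrow> bool" where
  "real_split_algebra m e A \<longleftrightarrow>
     (\<exists>\<phi> :: real^'n \<Rightarrow> real \<times> real. bij_betw \<phi> A UNIV \<and> \<phi> e = (1, 1) \<and>
        (\<forall>a\<in>A. \<forall>b\<in>A. \<phi> (a + b) = \<phi> a + \<phi> b \<and>
                      \<phi> (m a b) = (fst (\<phi> a) * fst (\<phi> b), snd (\<phi> a) * snd (\<phi> b))) \<and>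
        (\<forall>r. \<forall>a\<in>A. \<phi> (r *s a) = (r * fst (\<phi> a), r * snd (\<phi> a))))"

definition ortho_compl :: "('k::field^'n \<Rightarrow> 'k) \<Rightarrow> ('k^'n) set \<Rightarrow> ('k^'n) set" where
  "ortho_compl N A = {y. \<forall>a\<in>A. bform N a y = 0}"

text \<open>\<open>H(y,z) = (y,z)/2 + (xy,z)/(2x)\<close>, with values in the subalgebra \<open>A\<close> generated by \<open>x\<close>.\<close>

definition herm_form ::
  "('k::field^'n \<Rightarrow> 'k^'n \<Rightarrow> 'k^'n) \<Rightarrow> 'k^'n \<Rightarrow> ('k^'n \<Rightarrow> 'k) \<Rightarrow> 'k^'n \<Rightarrow> 'k^'n \<Rightarrow> 'k^'n \<Rightarrow> 'k^'n" where
  "herm_form m e N x y z =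
     (bform N y z / 2) *s e + (bform N (m x y) z / 2) *s oinverse e N x"

text \<open>The values \<open>H(y,y)\<close> of a Hermitian form are real multiples of the unit \<open>e\<close> of the algebra.
  The special unitary group of a Hermitian space is called definite or indefinite according to
  the form.\<close>

definition definite_hermitian :: "real^'n \<Rightarrow> (real^'n) set \<Rightarrow> (real^'n \<Rightarrow> real^'n \<Rightarrow> real^'n) \<Rightarrow> bool" where
  "definite_hermitian e V H \<longleftrightarrow>
     (\<forall>y\<in>V. y \<noteq> 0 \<longrightarrow> (\<exists>r>0. H y y = r *s e)) \<or> (\<forall>y\<in>V. y \<noteq> 0 \<longrightarrow> (\<exists>r<0. H y y = r *s e))"

definition indefinite_hermitian :: "real^'n \<Rightarrow> (real^'n) set \<Rightarrow> (real^'n \<Rightarrow> real^'n \<Rightarrow> real^'n) \<Rightarrow> bool" where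
  "indefinite_hermitian e V H \<longleftrightarrow>
     (\<exists>y\<in>V. \<exists>r>0. H y y = r *s e) \<and> (\<exists>y\<in>V. \<exists>r<0. H y y = r *s e)"


section \<open>Linear algebraic groups\<close>

text \<open>Linear algebraic groups are treated in the classical language, with \<open>\<complex>\<close> as universal domain.
  For a subfield \<open>K\<close> of \<open>\<complex>\<close>, an algebraic \<open>K\<close>-group is a subgroup of \<open>GL\<^sub>n(\<complex>)\<close> which is the zero
  locus of elements of \<open>K[GL\<^sub>n] = K[x\<^sub>i\<^sub>j, 1/det]\<close>; since the characteristic is 0, group schemes are
  reduced and this is the same as a closed \<open>K\<close>-subgroup scheme. Extension of scalars to
  \<open>K \<subseteq> L \<subseteq> \<complex>\<close> is the same subset of \<open>GL\<^sub>n(\<complex>)\<close>, regarded as an algebraic \<open>L\<close>-group.\<close>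

inductive_set regular_functions :: "complex set \<Rightarrow> (complex^'n^'n \<Rightarrow> complex) set"
  for K :: "complex set" where
  const: "c \<in> K \<Longrightarrow> (\<lambda>_. c) \<in> regular_functions K"
| entry: "(\<lambda>g. g $ i $ j) \<in> regular_functions K"
| inv_det: "(\<lambda>g. inverse (det g)) \<in> regular_functions K"
| add: "\<lbrakk>p \<in> regular_functions K; q \<in> regular_functions K\<rbrakk> \<Longrightarrow> (\<lambda>g. p g + q g) \<in> regular_functions K"
| mult: "\<lbrakk>p \<in> regular_functions K; q \<in> regular_functions K\<rbrakk> \<Longrightarrow> (\<lambda>g. p g * q g) \<in> regular_functions K"

definition zariski_closed :: "complex set \<Rightarrow> (complex^'n^'n) set \<Rightarrow> bool" where
  "zariski_closed K X \<longleftrightarrow>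
     (\<exists>S \<subseteq> regular_functions K. X = {g. invertible g \<and> (\<forall>p\<in>S. p g = 0)})"

definition matrix_group :: "(complex^'n^'n) set \<Rightarrow> (complex^'n^'n) monoid" where
  "matrix_group X = \<lparr>carrier = X, monoid.mult = (**), one = mat 1\<rparr>"

definition algebraic_group :: "complex set \<Rightarrow> (complex^'n^'n) set \<Rightarrow> bool" where
  "algebraic_group K X \<longleftrightarrow> group (matrix_group X) \<and> zariski_closed K X"

definition algebraic_hom ::
  "complex set \<Rightarrow> (complex^'n^'n) set \<Rightarrow> (complex^'m^'m) set \<Rightarrow> (complex^'n^'n \<Rightarrow> complex^'m^'m) \<Rightarrow> bool" where
  "algebraic_hom K X Y f \<longleftrightarrow> f \<in> hom (matrix_group X) (matrix_group Y) \<and>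
     (\<forall>i j. \<exists>p \<in> regular_functions K. \<forall>g\<in>X. f g $ i $ j = p g)"

definition algebraic_iso :: "complex set \<Rightarrow> (complex^'n^'n) set \<Rightarrow> (complex^'m^'m) set \<Rightarrow> bool" where
  "algebraic_iso K X Y \<longleftrightarrow>
     (\<exists>f f'. algebraic_hom K X Y f \<and> algebraic_hom K Y X f' \<and>
        (\<forall>g\<in>X. f' (f g) = g) \<and> (\<forall>g\<in>Y. f (f' g) = g))"

definition SL3 :: "(complex^3^3) set" where
  "SL3 = {g. det g = 1}"

definition aut_group :: "(complex^'n \<Rightarrow> complex^'n \<Rightarrow> complex^'n) \<Rightarrow> (complex^'n^'n) set" where
  "aut_group m = {g. invertible g \<and> (\<forall>u v. g *v m u v = m (g *v u) (g *v v))}"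


section \<open>Semisimple simply connected groups of type \<open>A\<^sub>2\<close>\<close>

text \<open>This is a property of the group over an algebraically closed field (here \<open>\<complex>\<close>).\<close>

definition zariski_connected :: "(complex^'n^'n) set \<Rightarrow> bool" where
  "zariski_connected X \<longleftrightarrow>
     \<not> (\<exists>Y Z. zariski_closed UNIV Y \<and> zariski_closed UNIV Z \<and>
          Y \<noteq> {} \<and> Z \<noteq> {} \<and> Y \<inter> Z = {} \<and> Y \<union> Z = X)"

definition semisimple :: "(complex^'n^'n) set \<Rightarrow> bool" where
  "semisimple X \<longleftrightarrow> algebraic_group UNIV X \<and> zariski_connected X \<and>
     (\<forall>R. algebraic_group UNIV R \<and> zariski_connected R \<and> R \<lhd> matrix_group X \<and>
          solvable (matrix_group R) \<longrightarrow> R = {mat 1})"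

definition torus :: "(complex^'n^'n) set \<Rightarrow> bool" where
  "torus T \<longleftrightarrow> algebraic_group UNIV T \<and> zariski_connected T \<and>
     (\<exists>P :: complex^'n^'n. invertible P \<and> (\<forall>t\<in>T. \<forall>i j. i \<noteq> j \<longrightarrow> (P ** t ** matrix_inv P) $ i $ j = 0))"

definition maximal_torus :: "(complex^'n^'n) set \<Rightarrow> (complex^'n^'n) set \<Rightarrow> bool" where
  "maximal_torus T X \<longleftrightarrow> torus T \<and> T \<subseteq> X \<and> (\<forall>T'. torus T' \<and> T \<subseteq> T' \<and> T' \<subseteq> X \<longrightarrow> T' = T)"

definition character :: "(complex^'n^'n) set \<Rightarrow> (complex^'n^'n \<Rightarrow> complex) \<Rightarrow> bool" where
  "character T c \<longleftrightarrow> (\<exists>p \<in> regular_functions UNIV. \<forall>t\<in>T. c t = p t) \<and>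
     (\<forall>t\<in>T. c t \<noteq> 0) \<and> (\<forall>s\<in>T. \<forall>t\<in>T. c (s ** t) = c s * c t)"

text \<open>The entries of a one-parameter subgroup are Laurent polynomials.\<close>

definition cocharacter :: "(complex^'n^'n) set \<Rightarrow> (complex \<Rightarrow> complex^'n^'n) \<Rightarrow> bool" where
  "cocharacter T a \<longleftrightarrow> (\<forall>i j. \<exists>p n. \<forall>z. z \<noteq> 0 \<longrightarrow> a z $ i $ j = poly p z / z ^ n) \<and>
     (\<forall>z. z \<noteq> 0 \<longrightarrow> a z \<in> T) \<and> (\<forall>z w. z \<noteq> 0 \<and> w \<noteq> 0 \<longrightarrow> a (z * w) = a z ** a w)"

definition pairing :: "(complex^'n^'n \<Rightarrow> complex) \<Rightarrow> (complex \<Rightarrow> complex^'n^'n) \<Rightarrow> int \<Rightarrow> bool" where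
  "pairing c a n \<longleftrightarrow> (\<forall>z. z \<noteq> 0 \<longrightarrow> c (a z) = z powi n)"

text \<open>The Lie algebra is the Zariski tangent space at the identity.\<close>

definition lie_algebra :: "(complex^'n^'n) set \<Rightarrow> (complex^'n^'n) set" where
  "lie_algebra X = {Z. \<forall>p \<in> regular_functions UNIV. (\<forall>g\<in>X. p g = 0) \<longrightarrow>
      ((\<lambda>s. p (mat 1 + map_matrix ((*) s) Z)) has_field_derivative 0) (at 0)}"

definition is_root ::
  "(complex^'n^'n) set \<Rightarrow> (complex^'n^'n) set \<Rightarrow> (complex^'n^'n \<Rightarrow> complex) \<Rightarrow> bool" where
  "is_root X T c \<longleftrightarrow> character T c \<and> (\<exists>t\<in>T. c t \<noteq> 1) \<and>
     (\<exists>Z \<in> lie_algebra X. Z \<noteq> 0 \<and> (\<forall>t\<in>T. t ** Z ** matrix_inv t = map_matrix ((*) (c t)) Z))"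

text \<open>The root system is of type \<open>A\<^sub>2\<close> with simple roots \<open>\<alpha>, \<beta>\<close> and simple coroots \<open>a, b\<close>, and the
  group is simply connected: the coroots generate the whole cocharacter lattice.\<close>

definition simply_connected_A2 :: "(complex^'n^'n) set \<Rightarrow> bool" where
  "simply_connected_A2 X \<longleftrightarrow> semisimple X \<and>
     (\<exists>T \<alpha> \<beta> a b. maximal_torus T X \<and>
        character T \<alpha> \<and> character T \<beta> \<and> cocharacter T a \<and> cocharacter T b \<and>
        (\<forall>c. character T c \<longrightarrow> (is_root X T c \<longleftrightarrow>
           (\<exists>(i, j) \<in> {(1, 0), (0, 1), (1, 1), (-1, 0), (0, -1), (-1, -1)}.
              \<forall>t\<in>T. c t = \<alpha> t powi i * \<beta> t powi j))) \<and>
        pairing \<alpha> a 2 \<and> pairing \<beta> a (-1) \<and> pairing \<alpha> b (-1) \<and> pairing \<beta> b 2 \<and>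
        (\<forall>d. cocharacter T d \<longrightarrow> (\<exists>i j. \<forall>z. z \<noteq> 0 \<longrightarrow> d z = a (z powi i) ** b (z powi j))))"

definition simply_connected_A2_subgroup ::
  "complex set \<Rightarrow> (complex^'n^'n) set \<Rightarrow> (complex^'n^'n) set \<Rightarrow> bool" where
  "simply_connected_A2_subgroup K G H \<longleftrightarrow> algebraic_group K H \<and> H \<subseteq> G \<and> simply_connected_A2 H"

end

theory Submission
  imports Defs
begin

text \<open>
  Extension of scalars along \<open>\<nu>\<close> turns the octonion algebra into an octonion
  algebra over \<open>\<real>\<close> (\<open>octonion_ext\<close>), and the image of
  \<open>x\<close> is still orthogonal to \<open>e\<close> with nonzero norm. So everything can be
  decided in a real octonion algebra, where \<open>A\<close> is the plane spanned by
  \<open>e\<close> and \<open>x\<close> with \<open>x\<^sup>2 = - N(x) e\<close>. Hence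
  \<open>A\<close> is imaginary exactly when \<open>N(x) > 0\<close>, and \<open>N(x) < 0\<close> if
  \<open>A\<close> is split.

  For the two statements on Hermitian forms, note \<open>H(y, y) = N(y)/2\<close> on the complement
  of \<open>A\<close> (\<open>herm_form_diagonal\<close>), so definiteness is a question about the
  norm on this complement. A definite norm is positive since \<open>N(e) = 1\<close>; thus
  \<open>N(x) > 0\<close> and the Hermitian form is definite. If the norm is indefinite but
  \<open>A\<close> imaginary, the norm is positive on \<open>A\<close> and so negative at some
  \<open>y\<close> in the complement; for \<open>z\<close> orthogonal to the quaternion algebra
  generated by \<open>x\<close> and \<open>y\<close>, one of \<open>z\<close> and \<open>y z\<close>
  has positive norm (\<open>indefinite_hermitian_if_indefinite\<close>).

  If \<open>A\<close> is split, the idempotents \<open>p\<close> and \<open>q\<close> of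
  \<open>A\<close> decompose its complement into two totally isotropic spaces \<open>V\<close> and
  \<open>W\<close> of dimension three, in duality through the bilinear form; the product of two
  vectors of \<open>V\<close> lies in \<open>W\<close> and conversely. A triple in \<open>V\<close>
  with \<open>2 (v1 v2, v3) = 1\<close> identifies the algebra with Zorn's algebra of vector
  matrices, in which these products are cross products (\<open>zorn_mult\<close>,
  \<open>zorn_expansion\<close>). An automorphism fixing \<open>x\<close> fixes \<open>p\<close> and
  \<open>q\<close> and therefore acts on \<open>V\<close> by some matrix \<open>h\<close>;
  compatibility with cross products makes it act on \<open>W\<close> by the cofactor matrix of
  \<open>h\<close>, and compatibility with the duality gives \<open>det h = 1\<close>. Conversely
  each such \<open>h\<close> defines an automorphism. Both passages are polynomial, and their
  coefficients are real because the triple is chosen over \<open>\<real>\<close>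
  (\<open>stabilizer_iso_SL3\<close>).
\<close>

section \<open>Composition identities in an octonion algebra\<close>

locale octonion =
  fixes m :: "'k::field_char_0^8 \<Rightarrow> 'k^8 \<Rightarrow> 'k^8" and e :: "'k^8" and N :: "'k^8 \<Rightarrow> 'k"
  assumes octonion: "octonion_algebra m e N"
begin

abbreviation "B \<equiv> bform N"
abbreviation "cj \<equiv> oconj e N"

lemma linear_mult_right: "Vector_Spaces.linear (*s) (*s) (m u)"
  and linear_mult_left: "Vector_Spaces.linear (*s) (*s) (\<lambda>u. m u v)"
  and linear_B: "Vector_Spaces.linear (*s) (*) (B u)"
  and unit_left [simp]: "m e u = u" and unit_right [simp]: "m u e = u"
  and N_scale: "N (a *s u) = a\<^sup>2 * N u"
  and N_mult: "N (m u v) = N u * N v"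
  using octonion by (simp_all add: octonion_algebra_def)

lemma nondegenerate: "(\<And>v. B u v = 0) \<Longrightarrow> u = 0"
  using octonion unfolding octonion_algebra_def by blast

lemma B_sym: "B u v = B v u"
  by (simp add: bform_def add.commute)

lemma B_add_right: "B u (v + w) = B u v + B u w"
  and B_scale_right: "B u (c *s v) = c * B u v"
  using linear_B by (auto simp: Vector_Spaces.linear_iff)

lemma B_add_left: "B (u + v) w = B u w + B v w"
  and B_scale_left: "B (c *s u) w = c * B u w"
  using B_add_right B_scale_right B_sym by metis+

lemma B_zero_right: "B u 0 = 0" and B_minus_right: "B u (- v) = - B u v"
  using B_scale_right[of u 0 0] B_scale_right[of u "-1" v] by simp_all

lemma B_zero_left: "B 0 u = 0" and B_minus_left: "B (- v) u = - B v u"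
  using B_zero_right B_minus_right B_sym by metis+

lemma B_diff_right: "B u (v - w) = B u v - B u w" and B_diff_left: "B (v - w) u = B v u - B w u"
  using B_add_right[of u v "-w"] B_add_left[of v "-w" u] by (simp_all add: B_minus_right B_minus_left)

lemma B_sum_right: "B u (\<Sum>i\<in>I. f i) = (\<Sum>i\<in>I. B u (f i))"
  by (induction I rule: infinite_finite_induct) (simp_all add: B_add_right B_zero_right)

lemma mult_add_right: "m u (v + w) = m u v + m u w"
  and mult_scale_right: "m u (c *s v) = c *s m u v"
  and mult_add_left: "m (u + v) w = m u w + m v w"
  and mult_scale_left: "m (c *s u) w = c *s m u w"
  using linear_mult_right linear_mult_left by (auto simp: Vector_Spaces.linear_iff)

lemma mult_zero_right: "m u 0 = 0" and mult_minus_right: "m u (- v) = - m u v"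
  and mult_zero_left: "m 0 u = 0" and mult_minus_left: "m (- v) u = - m v u"
  using mult_scale_right[of u 0 0] mult_scale_right[of u "-1" v]
    mult_scale_left[of 0 0 u] mult_scale_left[of "-1" v u] by simp_all

lemma mult_diff_right: "m u (v - w) = m u v - m u w"
  and mult_diff_left: "m (v - w) u = m v u - m w u"
  using mult_add_right[of u v "-w"] mult_add_left[of v "-w" u]
  by (simp_all add: mult_minus_right mult_minus_left)

lemmas B_linear =
  B_add_right B_scale_right B_zero_right B_minus_right B_diff_right
  B_add_left B_scale_left B_zero_left B_minus_left B_diff_left

lemmas mult_linear =
  mult_add_right mult_scale_right mult_zero_right mult_minus_right mult_diff_right
  mult_add_left mult_scale_left mult_zero_left mult_minus_left mult_diff_left

lemma N_add: "N (u + v) = N u + N v + 2 * B u v"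
  by (simp add: bform_def field_simps)

lemma B_self: "B u u = N u"
proof -
  have "u + u = 2 *s u" by (metis mult_2 one_add_one vec.scale_left_distrib vec.scale_one)
  then have "N (u + u) = 4 * N u" by (simp add: N_scale)
  then have "B u u = (4 * N u - N u - N u) / 2" by (simp only: bform_def)
  then show ?thesis by simp
qed

lemma N_unit: "N e = 1"
proof (rule ccontr)
  assume "N e \<noteq> 1"
  moreover have "N e * N e = N e" using N_mult[of e e] by simp
  ultimately have "N e = 0" by simp
  then have "N v = 0" for v using N_mult[of v e] by simp
  then have "B (axis 1 1) v = 0" for v by (simp add: bform_def)
  then have "(axis 1 1 :: 'k^8) = 0" by (rule nondegenerate)
  then show False by (simp add: axis_eq_0_iff)
qed

lemma B_mult_left: "B (m v w) (m v z) = N v * B w z"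
proof -
  have "N (m v w + m v z) = N v * N (w + z)" by (simp only: N_mult flip: mult_add_right)
  then show ?thesis by (simp add: bform_def N_mult right_diff_distrib)
qed

lemma B_mult_right: "B (m v z) (m w z) = B v w * N z"
proof -
  have "N (m v z + m w z) = N (v + w) * N z" by (simp only: N_mult flip: mult_add_left)
  then show ?thesis by (simp add: bform_def N_mult left_diff_distrib)
qed

text \<open>Full polarisation of \<open>N(v w) = N(v) N(w)\<close> with left factors \<open>v\<close> and \<open>e\<close> gives
  \<open>(v w, z) + (v z, w) = 2 (v, e) (w, z)\<close>. Since \<open>v + v\<^sup>\<sigma> = 2 (v, e) e\<close>, this identifies the adjoint of left
  multiplication by \<open>v\<close>.\<close>

lemma B_mult_adjoint: "B (m v w) z = B w (m (cj v) z)"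
proof -
  have "B (m v (w + z)) (m e (w + z)) = B v e * N (w + z)" by (rule B_mult_right)
  moreover have "B (m v w) w = B v e * N w" "B (m v z) z = B v e * N z"
    using B_mult_right[of v w e] B_mult_right[of v z e] by simp_all
  ultimately have "B (m v w) z + B (m v z) w = 2 * B v e * B w z"
    by (simp add: mult_add_right B_linear N_add algebra_simps)
  moreover have "B w (m (cj v) z) = 2 * B v e * B w z - B w (m v z)"
    by (simp add: oconj_def mult_linear B_linear)
  ultimately show ?thesis using B_sym[of "m v z" w] by (metis add_diff_cancel_right')
qed

lemma B_unit_unit: "B e e = 1"
  by (simp add: B_self N_unit)

lemma cj_cj: "cj (cj u) = u"
  unfolding oconj_def by (simp add: B_linear B_unit_unit algebra_simps)

lemma cj_pure: "B u e = 0 \<Longrightarrow> cj u = - u"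
  by (simp add: oconj_def)

lemma cj_add: "cj (u + w) = cj u + cj w"
  by (simp add: oconj_def B_linear algebra_simps vec.scale_left_distrib)

text \<open>Left multiplication by \<open>u\<close> multiplies the bilinear form by \<open>N(u)\<close>, so composing it with its adjoint gives
  multiplication by \<open>N(u)\<close>. This form of the left alternative law, once polarised, replaces associativity in
  calculations with products of three elements.\<close>

lemma left_cancel: "m (cj u) (m u z) = N u *s z"
proof -
  have "B (m (cj u) (m u z) - N u *s z) w = 0" for w
    using B_mult_adjoint[of "cj u" "m u z" w] B_mult_left[of u z w]
    by (simp add: B_linear cj_cj)
  then have "m (cj u) (m u z) - N u *s z = 0" by (rule nondegenerate)
  then show ?thesis by simp
qed

lemma left_cancel_polarized: "m (cj u) (m w z) + m (cj w) (m u z) = (2 * B u w) *s z"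
proof -
  have "m (cj (u + w)) (m (u + w) z) = N (u + w) *s z" by (rule left_cancel)
  then show ?thesis
    by (simp add: cj_add mult_linear left_cancel N_add vec.scale_left_distrib algebra_simps)
qed

lemma mult_cj_polarized: "m (cj u) w + m (cj w) u = (2 * B u w) *s e"
  using left_cancel_polarized[of u w e] by simp

lemma pure_square: "B u e = 0 \<Longrightarrow> m u u = - (N u *s e)"
  using left_cancel[of u e] by (simp add: cj_pure mult_linear minus_equation_iff[of "m u u"])

lemma pure_anticommute:
  assumes "B u e = 0" "B w e = 0"
  shows "m u w = - m w u - (2 * B u w) *s e"
  using mult_cj_polarized[of u w] assms
  by (simp add: cj_pure mult_linear) (metis (no_types, lifting) add.commute add_diff_cancel_left' diff_minus_eq_add minus_diff_eq uminus_add_conv_diff)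

section \<open>Orthogonal complements\<close>

lemma orthogonal_remainder:
  assumes "finite S" "\<And>a. a \<in> S \<Longrightarrow> N a \<noteq> 0" "\<And>a b. a \<in> S \<Longrightarrow> b \<in> S \<Longrightarrow> a \<noteq> b \<Longrightarrow> B a b = 0"
    and "b \<in> S"
  shows "B b (u - (\<Sum>a\<in>S. (B a u / N a) *s a)) = 0"
proof -
  have "(\<Sum>a\<in>S. B b ((B a u / N a) *s a)) = (\<Sum>a\<in>S. if a = b then B b u else 0)"
    using assms by (intro sum.cong refl) (auto simp: B_linear B_self)
  then show ?thesis using assms by (simp add: B_linear B_sum_right)
qed

text \<open>Fewer than eight vectors do not span. Subtracting orthogonal projections gives a nonzero vector
  orthogonal to \<open>S\<close>; if the norm vanished on the whole complement of \<open>S\<close>, polarisation would put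
  this vector in the radical of the bilinear form.\<close>

lemma anisotropic_orthogonal_exists:
  assumes "finite S" "card S < 8" "\<And>a. a \<in> S \<Longrightarrow> N a \<noteq> 0"
    "\<And>a b. a \<in> S \<Longrightarrow> b \<in> S \<Longrightarrow> a \<noteq> b \<Longrightarrow> B a b = 0"
  obtains z where "N z \<noteq> 0" "\<And>a. a \<in> S \<Longrightarrow> B a z = 0"
proof -
  define r where "r u = u - (\<Sum>a\<in>S. (B a u / N a) *s a)" for u
  have r: "B a (r u) = 0" if "a \<in> S" for a u
    unfolding r_def using orthogonal_remainder[OF assms(1,3,4) that] by blast
  have "vec.span S \<noteq> UNIV"
  proof
    assume "vec.span S = UNIV"
    then have "vec.dim (UNIV :: ('k^8) set) \<le> card S"
      using vec.dim_le_card[of UNIV S] assms(1) by simp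
    then show False using assms(2) by (simp only: vec_dim_card) simp
  qed
  then obtain u where u: "u \<notin> vec.span S" by blast
  have "(\<Sum>a\<in>S. (B a u / N a) *s a) \<in> vec.span S"
    by (intro vec.span_sum vec.span_scale vec.span_base)
  then have nz: "r u \<noteq> 0" using u by (auto simp: r_def)
  have "\<exists>z. N z \<noteq> 0 \<and> (\<forall>a\<in>S. B a z = 0)"
  proof (rule ccontr)
    assume neg: "\<not> ?thesis"
    have "B (r u) w = 0" for w
    proof -
      have "N (r u) = 0" "N (r w) = 0" "N (r u + r w) = 0"
        using neg r by (auto simp: B_linear)
      then have "B (r u) (r w) = 0" by (simp add: bform_def)
      moreover have "w = r w + (\<Sum>a\<in>S. (B a w / N a) *s a)" by (simp add: r_def)
      moreover have "B (r u) (\<Sum>a\<in>S. (B a w / N a) *s a) = 0"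
        using r[of _ u] by (simp add: B_sum_right B_linear B_sym[of "r u"])
      ultimately show ?thesis
        using B_add_right[of "r u" "r w" "\<Sum>a\<in>S. (B a w / N a) *s a"] by simp
    qed
    then have "r u = 0" by (rule nondegenerate)
    then show False using nz by simp
  qed
  then show ?thesis using that by blast
qed

lemma orthogonal_to_pure_exists:
  assumes "B e x = 0" "N x \<noteq> 0"
  obtains y where "N y \<noteq> 0" "B e y = 0" "B x y = 0"
proof (rule anisotropic_orthogonal_exists[of "{e, x}"])
  have "card {e, x} \<le> 2" by (simp add: card_insert_if)
  then show "card {e, x} < 8" by simp
qed (use assms that in \<open>auto simp: N_unit B_sym[of x e]\<close>)

text \<open>The vectors \<open>e, x, y, x y\<close> form an orthogonal basis of a quaternion subalgebra.\<close>

lemma orthogonal_to_quaternions_exists: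
  assumes x: "B e x = 0" "N x \<noteq> 0" and y: "B e y = 0" "B x y = 0" "N y \<noteq> 0"
  obtains z where "N z \<noteq> 0" "B e z = 0" "B x z = 0" "B y z = 0" "B (m x y) z = 0"
proof -
  have xy: "B e (m x y) = 0" "B x (m x y) = 0" "B y (m x y) = 0" "N (m x y) \<noteq> 0"
    using B_mult_adjoint[of x y e] B_mult_left[of x e y] B_mult_right[of e y x] x y
    by (simp_all add: cj_pure B_sym[of _ e] B_sym[of y] B_linear mult_linear N_mult)
  have "card {e, x, y, m x y} \<le> 4" by (simp add: card_insert_if)
  then have "card {e, x, y, m x y} < 8" by simp
  moreover have "N a \<noteq> 0" if "a \<in> {e, x, y, m x y}" for a
    using that x y xy by (auto simp: N_unit)
  moreover have "B a b = 0" if "a \<in> {e, x, y, m x y}" "b \<in> {e, x, y, m x y}" "a \<noteq> b" for a b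
    using that x y xy B_sym[of x e] B_sym[of y e] B_sym[of "m x y" e] B_sym[of y x]
      B_sym[of "m x y" x] B_sym[of "m x y" y] by auto
  ultimately obtain z where "N z \<noteq> 0" "\<And>a. a \<in> {e, x, y, m x y} \<Longrightarrow> B a z = 0"
    using anisotropic_orthogonal_exists[of "{e, x, y, m x y}"] by blast
  then show ?thesis using that by simp
qed

end

section \<open>Extension of scalars\<close>

lemma linear_vec_eq_on_axis:
  fixes f g :: "'l::field^'n \<Rightarrow> 'l^'p"
  assumes "Vector_Spaces.linear (*s) (*s) f" "Vector_Spaces.linear (*s) (*s) g"
    and "\<And>i. f (axis i 1) = g (axis i 1)"
  shows "f u = g u"
proof -
  interpret f: Vector_Spaces.linear "(*s)" "(*s)" f by fact
  interpret g: Vector_Spaces.linear "(*s)" "(*s)" g by fact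
  have "f (\<Sum>i\<in>UNIV. u $ i *s axis i 1) = g (\<Sum>i\<in>UNIV. u $ i *s axis i 1)"
    using assms(3) by (simp add: f.sum g.sum f.scale g.scale)
  then show ?thesis by (simp only: basis_expansion)
qed

lemma linear_form_eq_on_axis:
  fixes f g :: "'l::field^'n \<Rightarrow> 'l"
  assumes "\<And>u v. f (u + v) = f u + f v" "\<And>c u. f (c *s u) = c * f u"
    and "\<And>u v. g (u + v) = g u + g v" "\<And>c u. g (c *s u) = c * g u"
    and "\<And>i. f (axis i 1) = g (axis i 1)"
  shows "f u = g u"
proof -
  have "Vector_Spaces.linear (*s) (*) f" "Vector_Spaces.linear (*s) (*) g"
    using assms by (simp_all add: Vector_Spaces.linear_iff vec.vector_space_axioms
        vector_space_over_itself.vector_space_axioms)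
  then interpret f: Vector_Spaces.linear "(*s)" "(*)" f + g: Vector_Spaces.linear "(*s)" "(*)" g .
  have "f (\<Sum>i\<in>UNIV. u $ i *s axis i 1) = g (\<Sum>i\<in>UNIV. u $ i *s axis i 1)"
    using assms(5) by (simp add: f.sum g.sum f.scale g.scale)
  then show ?thesis by (simp only: basis_expansion)
qed

lemma sum_sum_delta:
  fixes f :: "'i::finite \<Rightarrow> 'j::finite \<Rightarrow> 'a::comm_monoid_add"
  shows "(\<Sum>i'\<in>UNIV. \<Sum>j'\<in>UNIV. if i' = i then if j' = j then f i' j' else 0 else 0) = f i j"
proof -
  have "(\<Sum>j'\<in>UNIV. if i' = i then if j' = j then f i' j' else 0 else 0) =
      (if i' = i then f i' j else 0)" for i'
    by simp
  then show ?thesis by simp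
qed

locale field_embedding =
  fixes h :: "'k::field_char_0 \<Rightarrow> 'l::field_char_0"
  assumes h_one [simp]: "h 1 = 1" and h_add: "h (a + b) = h a + h b"
    and h_mult: "h (a * b) = h a * h b"
begin

lemma h_zero [simp]: "h 0 = 0"
  using h_add[of 0 0] by simp

lemma h_minus: "h (- a) = - h a"
  using h_add[of a "- a"] by (simp add: add_eq_0_iff2)

lemma h_diff: "h (a - b) = h a - h b"
  using h_add[of a "- b"] by (simp add: h_minus)

lemma h_two [simp]: "h 2 = 2"
  using h_add[of 1 1] by simp

lemma h_sum: "h (\<Sum>i\<in>I. f i) = (\<Sum>i\<in>I. h (f i))"
  by (induction I rule: infinite_finite_induct) (simp_all add: h_add)

lemma h_eq_0_iff [simp]: "h a = 0 \<longleftrightarrow> a = 0"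
proof
  assume "h a = 0"
  then show "a = 0" using h_mult[of a "inverse a"] by (cases "a = 0") auto
qed simp

lemma h_if: "h (if P then a else b) = (if P then h a else h b)"
  by simp

lemma ext_vec_axis [simp]: "ext_vec h (axis i 1) = axis i 1"
  by (simp add: ext_vec_def axis_def vec_eq_iff)

lemma ext_vec_add: "ext_vec h (u + v) = ext_vec h u + ext_vec h v"
  and ext_vec_scale: "ext_vec h (c *s u) = h c *s ext_vec h u"
  and ext_vec_diff: "ext_vec h (u - v) = ext_vec h u - ext_vec h v"
  and ext_vec_zero: "ext_vec h 0 = 0"
  by (simp_all add: ext_vec_def vec_eq_iff h_add h_mult h_minus h_diff)

lemma ext_vec_sum: "ext_vec h (\<Sum>i\<in>I. f i) = (\<Sum>i\<in>I. ext_vec h (f i))"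
  by (induction I rule: infinite_finite_induct) (simp_all add: ext_vec_add ext_vec_zero)

lemma ext_mult_linear_right: "Vector_Spaces.linear (*s) (*s) (ext_mult h m u)"
  and ext_mult_linear_left: "Vector_Spaces.linear (*s) (*s) (\<lambda>u. ext_mult h m u v)"
  by (simp_all add: Vector_Spaces.linear_iff vec.vector_space_axioms ext_mult_def
      ring_distribs vec.scale_left_distrib sum.distrib vec.scale_sum_right mult_ac)

lemma ext_mult_axis [simp]: "ext_mult h m (axis i 1) (axis j 1) = ext_vec h (m (axis i 1) (axis j 1))"
proof -
  have "(axis i 1 $ i' * axis j 1 $ j') *s ext_vec h (m (axis i' 1) (axis j' 1)) =
      (if i' = i then if j' = j then ext_vec h (m (axis i' 1) (axis j' 1)) else 0 else 0)" for i' j'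
    by (auto simp: axis_def)
  then show ?thesis by (simp only: ext_mult_def sum_sum_delta)
qed

end

lemma field_embedding_real_place: "real_place \<nu> \<Longrightarrow> field_embedding \<nu>"
  by (simp add: real_place_def field_embedding_def)

lemma field_embedding_of_real: "field_embedding complex_of_real"
  by unfold_locales simp_all

locale octonion_extension = octonion m e N + field_embedding h
  for m :: "'k::field_char_0^8 \<Rightarrow> 'k^8 \<Rightarrow> 'k^8" and e N and h :: "'k \<Rightarrow> 'l::field_char_0"
begin

abbreviation "m' \<equiv> ext_mult h m"
abbreviation "e' \<equiv> ext_vec h e"
abbreviation "N' \<equiv> ext_form h N"
abbreviation "B' \<equiv> bform N'"

lemma ext_bform: "B' u v = (\<Sum>i\<in>UNIV. \<Sum>j\<in>UNIV. u $ i * v $ j * h (B (axis i 1) (axis j 1)))"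
proof -
  let ?b = "\<lambda>i j. h (B (axis i 1) (axis j 1))"
  let ?S = "\<lambda>u v. \<Sum>i\<in>UNIV. \<Sum>j\<in>UNIV. u $ i * v $ j * ?b i j"
  have "?S v u = (\<Sum>j\<in>UNIV. \<Sum>i\<in>UNIV. v $ i * u $ j * ?b i j)" by (rule sum.swap)
  also have "\<dots> = ?S u v" by (intro sum.cong refl) (simp add: B_sym mult_ac)
  finally have "?S v u = ?S u v" .
  moreover have "N' (u + v) = ?S u u + ?S u v + ?S v u + ?S v v"
    by (simp add: ext_form_def ring_distribs sum.distrib)
  ultimately show ?thesis by (simp add: bform_def ext_form_def)
qed

lemma ext_B_add_right: "B' u (v + w) = B' u v + B' u w"
  and ext_B_scale_right: "B' u (c *s v) = c * B' u v"
  and ext_B_add_left: "B' (u + v) w = B' u w + B' v w"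
  and ext_B_scale_left: "B' (c *s u) w = c * B' u w"
  by (simp_all add: ext_bform ring_distribs sum.distrib sum_distrib_left mult_ac)

lemma ext_B_axis [simp]: "B' (axis i 1) (axis j 1) = h (B (axis i 1) (axis j 1))"
proof -
  have "axis i 1 $ i' * axis j 1 $ j' * h (B (axis i' 1) (axis j' 1)) =
      (if i' = i then if j' = j then h (B (axis i' 1) (axis j' 1)) else 0 else 0)" for i' j'
    by (auto simp: axis_def)
  then show ?thesis by (simp only: ext_bform sum_sum_delta)
qed

lemma ext_B_ext_vec: "B' (ext_vec h u) (ext_vec h v) = h (B u v)"
proof -
  have "B u v = B (\<Sum>i\<in>UNIV. u $ i *s axis i 1) (\<Sum>i\<in>UNIV. v $ i *s axis i 1)"
    by (simp only: basis_expansion)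
  also have "\<dots> = (\<Sum>i\<in>UNIV. \<Sum>j\<in>UNIV. u $ i * v $ j * B (axis i 1) (axis j 1))"
    by (subst sum.swap) (simp add: B_sum_right B_sym[of "sum _ _"] B_linear sum_distrib_left mult_ac B_sym)
  finally show ?thesis by (simp add: ext_bform h_sum h_mult ext_vec_def)
qed

lemma ext_mult_ext_vec: "m' (ext_vec h u) (ext_vec h v) = ext_vec h (m u v)"
proof -
  have sum_right: "m u (\<Sum>i\<in>I. f i) = (\<Sum>i\<in>I. m u (f i))" for u I and f :: "8 \<Rightarrow> _"
    by (induction I rule: infinite_finite_induct) (simp_all add: mult_linear)
  have sum_left: "m (\<Sum>i\<in>I. f i) u = (\<Sum>i\<in>I. m (f i) u)" for u I and f :: "8 \<Rightarrow> _"
    by (induction I rule: infinite_finite_induct) (simp_all add: mult_linear)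
  have "m u v = m (\<Sum>i\<in>UNIV. u $ i *s axis i 1) (\<Sum>i\<in>UNIV. v $ i *s axis i 1)"
    by (simp only: basis_expansion)
  also have "\<dots> = (\<Sum>i\<in>UNIV. \<Sum>j\<in>UNIV. (u $ i * v $ j) *s m (axis i 1) (axis j 1))"
    by (simp only: sum_left mult_scale_left)
      (simp add: sum_right mult_scale_right vec.scale_sum_right)
  finally show ?thesis
    by (simp add: ext_mult_def ext_vec_sum ext_vec_scale h_mult ext_vec_def[of h u] ext_vec_def[of h v])
qed

lemma ext_N_ext_vec: "N' (ext_vec h u) = h (N u)"
proof -
  have "N' v = B' v v" for v by (simp add: ext_form_def ext_bform)
  then show ?thesis by (simp add: ext_B_ext_vec B_self)
qed

text \<open>A matrix that inverts the Gram matrix of a basis still inverts it after applying \<open>h\<close>.\<close>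

lemma ext_nondegenerate:
  assumes "\<And>v. B' u v = 0"
  shows "u = 0"
proof -
  define M where "M = (\<chi> i j. B (axis i 1) (axis j 1))"
  have Mv: "M *v u = (\<chi> i. B (axis i 1) u)" for u
  proof -
    have "B (axis i 1) u = B (axis i 1) (\<Sum>j\<in>UNIV. u $ j *s axis j 1)" for i
      by (simp only: basis_expansion)
    then show ?thesis
      by (simp add: M_def matrix_vector_mult_def vec_eq_iff B_sum_right B_linear mult.commute)
  qed
  have "u = 0" if "M *v u = 0" for u
  proof (intro nondegenerate)
    fix v
    have "B u v = B v u" by (rule B_sym)
    also have "\<dots> = 0"
      using Mv[of u] that
      by (intro linear_form_eq_on_axis[where f = "\<lambda>v. B v u" and g = "\<lambda>_. 0" and u = v])
        (simp_all add: B_linear vec_eq_iff)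
    finally show "B u v = 0" .
  qed
  then have "\<exists>M'. M' ** M = mat 1"
    by (simp add: matrix_left_invertible_ker)
  then obtain M' where M': "M' ** M = mat 1" ..
  have inv: "(\<Sum>j\<in>UNIV. h (M' $ i $ j) * h (M $ j $ l)) = (if i = l then 1 else 0)" for i l
  proof -
    have "(\<Sum>j\<in>UNIV. M' $ i $ j * M $ j $ l) = (if i = l then 1 else 0)"
      using M' by (simp add: matrix_matrix_mult_def mat_def vec_eq_iff)
    then have "h (\<Sum>j\<in>UNIV. M' $ i $ j * M $ j $ l) = h (if i = l then 1 else 0)" by (simp only:)
    then show ?thesis by (simp only: h_sum h_mult h_if h_one h_zero)
  qed
  have zero: "(\<Sum>l\<in>UNIV. h (M $ j $ l) * u $ l) = 0" for j
  proof -
    have "0 = B' u (axis j 1)" using assms by simp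
    also have "\<dots> = (\<Sum>l\<in>UNIV. \<Sum>j'\<in>UNIV. if j' = j then u $ l * h (B (axis l 1) (axis j 1)) else 0)"
      unfolding ext_bform by (intro sum.cong refl) (simp add: axis_def)
    finally show ?thesis by (simp add: M_def B_sym mult.commute)
  qed
  have "u $ i = 0" for i
  proof -
    have "u $ i = (\<Sum>l\<in>UNIV. (\<Sum>j\<in>UNIV. h (M' $ i $ j) * h (M $ j $ l)) * u $ l)"
      by (simp add: inv if_distrib[of "\<lambda>x. x * _"] cong: if_cong)
    also have "\<dots> = (\<Sum>l\<in>UNIV. \<Sum>j\<in>UNIV. h (M' $ i $ j) * (h (M $ j $ l) * u $ l))"
      by (simp add: sum_distrib_right mult.assoc)
    also have "\<dots> = (\<Sum>j\<in>UNIV. \<Sum>l\<in>UNIV. h (M' $ i $ j) * (h (M $ j $ l) * u $ l))"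
      by (rule sum.swap)
    also have "\<dots> = 0" by (simp add: zero flip: sum_distrib_left)
    finally show ?thesis .
  qed
  then show ?thesis by (simp add: vec_eq_iff)
qed

text \<open>The multiplicativity of the norm has degree two in each factor. It descends to basis vectors
  only after polarisation in both factors, which turns it into an identity between quadrilinear
  forms.\<close>

lemma ext_N_mult: "N' (m' u v) = N' u * N' v"
proof -
  note lin = ext_B_add_right ext_B_scale_right ext_B_add_left ext_B_scale_left
    ext_mult_linear_left[THEN vec.linear_add] ext_mult_linear_left[THEN vec.linear_scale]
    ext_mult_linear_right[THEN vec.linear_add] ext_mult_linear_right[THEN vec.linear_scale]
  have pol: "B (m u v) (m w z) + B (m u z) (m w v) = 2 * B u w * B v z" for u v w z
  proof -
    have "B (m u (v + z)) (m w (v + z)) = B u w * N (v + z)" by (rule B_mult_right)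
    then show ?thesis by (simp add: mult_linear B_linear B_mult_right N_add algebra_simps)
  qed
  let ?P = "\<lambda>u v w z. B' (m' u v) (m' w z) + B' (m' u z) (m' w v) = 2 * B' u w * B' v z"
  let ?a = "\<lambda>i. axis i 1"
  have 1: "?P (?a i) (?a j) (?a k) (?a l)" for i j k l
  proof -
    have "h (B (m (?a i) (?a j)) (m (?a k) (?a l)) + B (m (?a i) (?a l)) (m (?a k) (?a j))) =
        h (2 * B (?a i) (?a k) * B (?a j) (?a l))"
      by (simp only: pol)
    then show ?thesis by (simp add: ext_B_ext_vec h_add h_mult)
  qed
  have 2: "?P (?a i) (?a j) (?a k) z" for i j k z
    by (rule linear_form_eq_on_axis[where u = z and f = "\<lambda>x. B' (m' (?a i) (?a j)) (m' (?a k) x) + B' (m' (?a i) x) (m' (?a k) (?a j))"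
        and g = "\<lambda>x. 2 * B' (?a i) (?a k) * B' (?a j) x"])
      (rule 1 | simp add: lin algebra_simps del: ext_mult_axis ext_B_axis)+
  have 3: "?P (?a i) (?a j) w z" for i j w z
    by (rule linear_form_eq_on_axis[where u = w and f = "\<lambda>x. B' (m' (?a i) (?a j)) (m' x z) + B' (m' (?a i) z) (m' x (?a j))"
        and g = "\<lambda>x. 2 * B' (?a i) x * B' (?a j) z"])
      (rule 2 | simp add: lin algebra_simps del: ext_mult_axis ext_B_axis)+
  have 4: "?P (?a i) v w z" for i v w z
    by (rule linear_form_eq_on_axis[where u = v and f = "\<lambda>x. B' (m' (?a i) x) (m' w z) + B' (m' (?a i) z) (m' w x)"
        and g = "\<lambda>x. 2 * B' (?a i) w * B' x z"])
      (rule 3 | simp add: lin algebra_simps del: ext_mult_axis ext_B_axis)+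
  have "?P u v u v"
    by (rule linear_form_eq_on_axis[where u = u and f = "\<lambda>x. B' (m' x v) (m' u v) + B' (m' x v) (m' u v)"
        and g = "\<lambda>x. 2 * B' x u * B' v v"])
      (rule 4 | simp add: lin algebra_simps del: ext_mult_axis ext_B_axis)+
  moreover have "N' v = B' v v" for v by (simp add: ext_form_def ext_bform)
  ultimately show ?thesis by simp
qed

theorem octonion_ext: "octonion m' e' N'"
proof (unfold_locales, unfold octonion_algebra_def, intro conjI allI impI)
  fix u v :: "'l^8" and a
  have left: "m' e' u = u"
  proof (rule linear_vec_eq_on_axis[where g = "\<lambda>u. u", OF ext_mult_linear_right vec.linear_ident])
    show "m' e' (axis i 1) = axis i 1" for i
      using ext_mult_ext_vec[of e "axis i 1"] by simp
  qed
  have right: "m' u e' = u"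
  proof (rule linear_vec_eq_on_axis[where g = "\<lambda>u. u", OF ext_mult_linear_left vec.linear_ident])
    show "m' (axis i 1) e' = axis i 1" for i
      using ext_mult_ext_vec[of "axis i 1" e] by simp
  qed
  show "m' e' u = u" "m' u e' = u" by (fact left right)+
  show "N' (a *s u) = a\<^sup>2 * N' u"
    by (simp add: ext_form_def sum_distrib_left power2_eq_square mult_ac)
  show "Vector_Spaces.linear (*s) (*) (B' u)"
    by (simp add: Vector_Spaces.linear_iff vec.vector_space_axioms
        vector_space_over_itself.vector_space_axioms ext_B_add_right ext_B_scale_right)
  show "N' (m' u v) = N' u * N' v" by (rule ext_N_mult)
  show "u = 0" if "\<forall>v. B' u v = 0" by (rule ext_nondegenerate) (use that in blast)
qed (fact ext_mult_linear_right ext_mult_linear_left)+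

end

lemma ext_mult_comp:
  "field_embedding g \<Longrightarrow> ext_mult g (ext_mult h m) = ext_mult (g \<circ> h) m" if "field_embedding h"
proof (intro ext)
  interpret h: field_embedding h by fact
  assume "field_embedding g"
  fix u v
  show "ext_mult g (ext_mult h m) u v = ext_mult (g \<circ> h) m u v"
    unfolding ext_mult_def[of g] h.ext_mult_axis by (simp add: ext_mult_def ext_vec_def)
qed

section \<open>The quadratic subalgebra and the Hermitian form\<close>

context octonion
begin

lemma in_span_pure_iff: "a \<in> vec.span {e, x} \<longleftrightarrow> (\<exists>\<alpha> \<beta>. a = \<alpha> *s e + \<beta> *s x)"
  by (simp add: vec.span_insert vec.span_singleton algebra_simps)

lemma mult_span_pure:
  assumes "B x e = 0"
  shows "m (\<alpha> *s e + \<beta> *s x) (\<gamma> *s e + \<delta> *s x) =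
    (\<alpha> * \<gamma> - \<beta> * \<delta> * N x) *s e + (\<alpha> * \<delta> + \<beta> * \<gamma>) *s x"
  by (simp add: mult_linear pure_square[OF assms] vec.scale_left_distrib vec.scale_left_diff_distrib
      vec.scale_right_distrib mult_ac)

lemma generated_subalgebra_pure:
  assumes "B x e = 0"
  shows "generated_subalgebra m e {x} = vec.span {e, x}"
proof (rule antisym)
  have "m a b \<in> vec.span {e, x}" if ab: "a \<in> vec.span {e, x}" "b \<in> vec.span {e, x}" for a b
  proof -
    obtain \<alpha> \<beta> where a: "a = \<alpha> *s e + \<beta> *s x" using ab(1) unfolding in_span_pure_iff by (elim exE)
    obtain \<gamma> \<delta> where b: "b = \<gamma> *s e + \<delta> *s x" using ab(2) unfolding in_span_pure_iff by (elim exE)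
    show ?thesis
      unfolding in_span_pure_iff a b mult_span_pure[OF assms] by (intro exI) (rule refl)
  qed
  moreover have "e \<in> vec.span {e, x}" "{x} \<subseteq> vec.span {e, x}"
    by (auto intro: vec.span_base)
  ultimately show "generated_subalgebra m e {x} \<subseteq> vec.span {e, x}"
    unfolding generated_subalgebra_def by (intro Inter_lower) simp
  show "vec.span {e, x} \<subseteq> generated_subalgebra m e {x}"
    unfolding generated_subalgebra_def by (intro Inter_greatest vec.span_minimal) auto
qed

lemma ortho_compl_span_pure: "y \<in> ortho_compl N (vec.span {e, x}) \<longleftrightarrow> B e y = 0 \<and> B x y = 0"
proof
  assume "y \<in> ortho_compl N (vec.span {e, x})"
  moreover have "e \<in> vec.span {e, x}" "x \<in> vec.span {e, x}" by (auto intro: vec.span_base)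
  ultimately show "B e y = 0 \<and> B x y = 0" by (auto simp: ortho_compl_def)
next
  assume "B e y = 0 \<and> B x y = 0"
  then show "y \<in> ortho_compl N (vec.span {e, x})"
    by (auto simp: ortho_compl_def in_span_pure_iff B_linear)
qed

text \<open>The second term of \<open>H(y, y)\<close> carries the factor \<open>(x y, y) = (x, 1) N(y)\<close>, which vanishes for
  pure \<open>x\<close>: the Hermitian form and half the norm form take the same values.\<close>

lemma herm_form_diagonal:
  assumes "B x e = 0"
  shows "herm_form m e N x y y = (N y / 2) *s e"
  using B_mult_right[of x y e] assms by (simp add: herm_form_def B_self)

lemma unit_nonzero: "e \<noteq> 0"
  using N_unit N_scale[of 0 e] by auto

end

locale real_octonion = octonion m e N for m :: "real^8 \<Rightarrow> real^8 \<Rightarrow> real^8" and e and N +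
  fixes x :: "real^8"
  assumes x_pure: "B x e = 0" and x_anisotropic: "N x \<noteq> 0"
begin

lemma x_pure': "B e x = 0"
  using x_pure by (simp add: B_sym)

lemma imaginary_algebra_if_pos:
  assumes "N x > 0"
  shows "imaginary_algebra m e (vec.span {e, x})"
  unfolding imaginary_algebra_def
proof (intro exI conjI ballI allI)
  define s where "s = sqrt (N x)"
  have s: "s > 0" "s * s = N x" using assms by (simp_all add: s_def)
  define \<phi> where "\<phi> u = Complex (B u e) (B u x / s)" for u
  have \<phi>: "\<phi> (\<alpha> *s e + \<beta> *s x) = Complex \<alpha> (\<beta> * s)" for \<alpha> \<beta>
    using s by (simp add: \<phi>_def B_linear B_self N_unit x_pure x_pure' field_simps)
  show "bij_betw \<phi> (vec.span {e, x}) UNIV"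
  proof (rule bij_betw_byWitness[where f' = "\<lambda>z. Re z *s e + (Im z / s) *s x"])
    show "\<forall>a\<in>vec.span {e, x}. Re (\<phi> a) *s e + (Im (\<phi> a) / s) *s x = a"
      using s(1) by (auto simp: in_span_pure_iff \<phi>)
    show "\<forall>z\<in>UNIV. \<phi> (Re z *s e + (Im z / s) *s x) = z"
      using s(1) by (simp add: \<phi>)
    show "(\<lambda>z. Re z *s e + (Im z / s) *s x) ` UNIV \<subseteq> vec.span {e, x}"
      unfolding image_subset_iff in_span_pure_iff by (intro ballI exI) (rule refl)
  qed auto
  show "\<phi> e = 1"
    using \<phi>[of 1 0] by (simp add: complex_eq_iff)
  fix a b assume "a \<in> vec.span {e, x}" "b \<in> vec.span {e, x}"
  then obtain \<alpha> \<beta> \<gamma> \<delta> where ab: "a = \<alpha> *s e + \<beta> *s x" "b = \<gamma> *s e + \<delta> *s x"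
    unfolding in_span_pure_iff by (elim exE)
  show "\<phi> (a + b) = \<phi> a + \<phi> b"
    by (simp add: \<phi>_def B_linear complex_eq_iff add_divide_distrib)
  show "\<phi> (m a b) = \<phi> a * \<phi> b"
    unfolding ab mult_span_pure[OF x_pure] \<phi>
    by (simp add: complex_eq_iff s(2)[symmetric] algebra_simps)
next
  fix r a
  show "Complex (B (r *s a) e) (B (r *s a) x / sqrt (N x)) =
      complex_of_real r * Complex (B a e) (B a x / sqrt (N x))"
    by (simp add: B_linear complex_eq_iff)
qed

text \<open>The image of \<open>x\<close> in \<open>\<complex>\<close> squares to the real number \<open>- N(x)\<close> and is not itself real, because \<open>x\<close>
  is not a multiple of \<open>e\<close>.\<close>

lemma pos_if_imaginary_algebra:
  assumes "imaginary_algebra m e (vec.span {e, x})"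
  shows "N x > 0"
proof -
  obtain \<phi> where inj: "inj_on \<phi> (vec.span {e, x})" and unit: "\<phi> e = 1"
    and mult: "\<And>a b. a \<in> vec.span {e, x} \<Longrightarrow> b \<in> vec.span {e, x} \<Longrightarrow> \<phi> (m a b) = \<phi> a * \<phi> b"
    and scale: "\<And>r a. a \<in> vec.span {e, x} \<Longrightarrow> \<phi> (r *s a) = complex_of_real r * \<phi> a"
    using assms unfolding imaginary_algebra_def bij_betw_def by (elim exE conjE) simp
  have mem: "e \<in> vec.span {e, x}" "x \<in> vec.span {e, x}" by (auto intro: vec.span_base)
  have sq: "\<phi> x * \<phi> x = complex_of_real (- N x)"
    using mult[OF mem(2,2)] scale[OF mem(1), of "- N x"]
    by (simp add: pure_square[OF x_pure] unit)
  have "Im (\<phi> x) \<noteq> 0"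
  proof
    assume "Im (\<phi> x) = 0"
    then have "\<phi> x = \<phi> (Re (\<phi> x) *s e)"
      using scale[OF mem(1)] by (simp add: unit complex_eq_iff)
    then have "x = Re (\<phi> x) *s e"
      by (rule inj_onD[OF inj]) (simp_all add: mem vec.span_scale)
    then have "B x x = Re (\<phi> x) * B x e"
      by (metis B_scale_right)
    then show False using x_pure x_anisotropic by (simp add: B_self)
  qed
  moreover have "Re (\<phi> x) * Im (\<phi> x) = 0" "Re (\<phi> x) * Re (\<phi> x) - Im (\<phi> x) * Im (\<phi> x) = - N x"
    using arg_cong[OF sq, of Im] arg_cong[OF sq, of Re] by auto
  ultimately have "Im (\<phi> x) \<noteq> 0" "N x = Im (\<phi> x) * Im (\<phi> x)" by simp_all
  then show ?thesis by (metis not_square_less_zero linorder_neqE_linordered_idom mult_eq_0_iff)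
qed

lemma neg_if_real_split_algebra:
  assumes "real_split_algebra m e (vec.span {e, x})"
  shows "N x < 0"
proof -
  obtain \<phi> where unit: "\<phi> e = (1, 1)"
    and mult: "\<And>a b. a \<in> vec.span {e, x} \<Longrightarrow> b \<in> vec.span {e, x} \<Longrightarrow>
        \<phi> (m a b) = (fst (\<phi> a) * fst (\<phi> b), snd (\<phi> a) * snd (\<phi> b))"
    and scale: "\<And>r a. a \<in> vec.span {e, x} \<Longrightarrow> \<phi> (r *s a) = (r * fst (\<phi> a), r * snd (\<phi> a))"
    using assms unfolding real_split_algebra_def by (elim exE conjE) simp
  have mem: "e \<in> vec.span {e, x}" "x \<in> vec.span {e, x}" by (auto intro: vec.span_base)
  have "(fst (\<phi> x) * fst (\<phi> x), snd (\<phi> x) * snd (\<phi> x)) = (- N x, - N x)"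
    using mult[OF mem(2,2)] scale[OF mem(1), of "- N x"]
    by (simp add: pure_square[OF x_pure] unit)
  then have "- N x \<ge> 0" by (metis prod.inject zero_le_square)
  then show ?thesis using x_anisotropic by simp
qed

lemma definite_form_pos:
  assumes "definite_form N" "u \<noteq> 0"
  shows "N u > 0"
proof -
  have "\<not> N e < 0" by (simp add: N_unit)
  then show ?thesis using assms unit_nonzero unfolding definite_form_def by blast
qed

lemma definite_hermitian_if_definite:
  assumes "definite_form N"
  shows "definite_hermitian e (ortho_compl N (vec.span {e, x})) (herm_form m e N x)"
proof -
  have "\<exists>r>0. herm_form m e N x y y = r *s e" if "y \<noteq> 0" for y
    using definite_form_pos[OF assms that] by (intro exI[of _ "N y / 2"]) (simp add: herm_form_diagonal x_pure)
  then show ?thesis unfolding definite_hermitian_def by simp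
qed

text \<open>Since the norm is positive on the plane spanned by \<open>e\<close> and \<open>x\<close>, it is negative at some \<open>y\<close> of
  the orthogonal complement. For \<open>z\<close> orthogonal to the quaternion subalgebra generated by \<open>x\<close> and
  \<open>y\<close>, the product \<open>y z\<close> lies in the complement as well, and its norm \<open>N(y) N(z)\<close> has the sign opposite to
  that of \<open>N(z)\<close>. So the norm also takes positive values on the complement.\<close>

lemma indefinite_hermitian_if_indefinite:
  assumes "indefinite_form N" "N x > 0"
  shows "indefinite_hermitian e (ortho_compl N (vec.span {e, x})) (herm_form m e N x)"
proof -
  obtain u where u: "N u < 0" using assms(1) unfolding indefinite_form_def by (elim conjE exE)
  define y where "y = u - B e u *s e - (B x u / N x) *s x"
  have y: "B e y = 0" "B x y = 0"
    using assms(2) by (simp_all add: y_def B_linear B_self N_unit x_pure x_pure')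
  have "N u = N (B e u *s e + (B x u / N x) *s x + y)"
    by (simp add: y_def)
  also have "\<dots> = (B e u)\<^sup>2 + (B x u)\<^sup>2 / N x + N y"
    using assms(2) y by (simp add: N_add N_scale B_linear N_unit x_pure' power2_eq_square)
  finally have Ny: "N y < 0"
    using u assms(2) by (smt (verit) divide_nonneg_pos zero_le_power2)
  obtain z where z: "N z \<noteq> 0" "B e z = 0" "B x z = 0" "B y z = 0" "B (m x y) z = 0"
    using orthogonal_to_quaternions_exists[OF x_pure' x_anisotropic y] Ny by (metis less_irrefl)
  have yz: "B e (m y z) = 0" "B x (m y z) = 0" "N (m y z) = N y * N z"
  proof -
    have cy: "cj y = - y" using y(1) by (simp add: cj_pure B_sym)
    have "m y x = - m x y" using y pure_anticommute[of y x] x_pure by (simp add: B_sym[of y])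
    then show "B e (m y z) = 0" "B x (m y z) = 0"
      using B_mult_adjoint[of y z e] B_mult_adjoint[of y z x] z cy
      by (simp_all add: B_sym[of _ "m y z"] mult_linear B_linear B_sym[of z])
    show "N (m y z) = N y * N z" by (rule N_mult)
  qed
  obtain w where w: "B e w = 0" "B x w = 0" "N w > 0"
  proof (cases "N z > 0")
    case True
    then show thesis using that z by simp
  next
    case False
    then have "N z < 0" using z(1) by simp
    then show thesis using that[OF yz(1,2)] Ny by (simp add: yz(3) mult_neg_neg)
  qed
  have "\<exists>y\<in>ortho_compl N (vec.span {e, x}). \<exists>r>0. herm_form m e N x y y = r *s e"
    using w by (intro bexI[of _ w] exI[of _ "N w / 2"])
      (simp_all add: ortho_compl_span_pure herm_form_diagonal x_pure)
  moreover have "\<exists>y\<in>ortho_compl N (vec.span {e, x}). \<exists>r<0. herm_form m e N x y y = r *s e"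
    using y Ny by (intro bexI[of _ y] exI[of _ "N y / 2"])
      (simp_all add: ortho_compl_span_pure herm_form_diagonal x_pure)
  ultimately show ?thesis unfolding indefinite_hermitian_def ..
qed

end

section \<open>Isotropic idempotents and the Peirce decomposition\<close>

text \<open>The first two conditions say that \<open>v\<close> is orthogonal to the quadratic subalgebra spanned by
  \<open>p\<close> and \<open>q\<close>. For isotropic idempotents \<open>p\<close> and \<open>q\<close> with sum \<open>e\<close> this cuts out the Peirce component
  \<open>p O q\<close>; exchanging \<open>p\<close> and \<open>q\<close> gives \<open>q O p\<close>.\<close>

definition peirce_space ::
  "('k::field^'n \<Rightarrow> 'k^'n \<Rightarrow> 'k^'n) \<Rightarrow> ('k^'n \<Rightarrow> 'k) \<Rightarrow> 'k^'n \<Rightarrow> 'k^'n \<Rightarrow> ('k^'n) set" where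
  "peirce_space m N p q = {v. bform N p v = 0 \<and> bform N q v = 0 \<and> m p v = v}"

locale peirce = octonion +
  fixes p q
  assumes sum_unit: "p + q = e" and isotropic_p: "N p = 0" and isotropic_q: "N q = 0"
begin

text \<open>The hypotheses are symmetric in \<open>p\<close> and \<open>q\<close>. Statements about \<open>V\<close> and \<open>W\<close> below are therefore proved for
  one of the two spaces and transferred to the other, in alternation.\<close>

lemma swap: "peirce m e N q p"
  by unfold_locales (simp_all add: sum_unit add.commute isotropic_p isotropic_q)

lemma B_pq: "B p q = 1/2" and B_qp: "B q p = 1/2"
  and B_pp: "B p p = 0" and B_qq: "B q q = 0"
  and B_pe: "B p e = 1/2"
proof -
  have "N (p + q) = 1" by (simp add: sum_unit N_unit)
  then show *: "B p q = 1/2" by (simp add: N_add isotropic_p isotropic_q field_simps)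
  then show "B q p = 1/2" by (simp add: B_sym)
  show "B p p = 0" "B q q = 0" by (simp_all add: B_self isotropic_p isotropic_q)
  then show "B p e = 1/2" using * by (simp add: B_linear flip: sum_unit)
qed

lemma cj_p: "cj p = q"
  by (simp add: oconj_def B_pe) (simp flip: sum_unit)

lemma mult_q_p_left: "m q (m p z) = 0"
  using left_cancel[of p z] by (simp add: cj_p isotropic_p)

lemma mult_qp: "m q p = 0"
  using mult_q_p_left[of e] by simp

lemma split_vector: "m p z + m q z = z"
  by (simp flip: mult_add_left add: sum_unit)

lemma mult_pp: "m p p = p"
  using split_vector[of p] by (simp add: mult_qp)

end

context peirce
begin

interpretation sw: peirce m e N q p by (rule swap)

lemmas cj_q = sw.cj_p
lemmas mult_pq = sw.mult_qp
lemmas mult_qq = sw.mult_pp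
lemmas mult_p_q_left = sw.mult_q_p_left

abbreviation "V \<equiv> peirce_space m N p q"
abbreviation "W \<equiv> peirce_space m N q p"

lemma mult_p_V: "v \<in> V \<Longrightarrow> m p v = v"
  and B_p_V: "v \<in> V \<Longrightarrow> B p v = 0" and B_q_V: "v \<in> V \<Longrightarrow> B q v = 0"
  and B_V_p: "v \<in> V \<Longrightarrow> B v p = 0" and B_V_q: "v \<in> V \<Longrightarrow> B v q = 0"
  by (simp_all add: peirce_space_def B_sym)

lemma mult_q_V: "v \<in> V \<Longrightarrow> m q v = 0"
  using mult_q_p_left[of v] by (simp add: mult_p_V)

lemma cj_V: "v \<in> V \<Longrightarrow> cj v = - v"
  by (rule cj_pure) (simp add: B_linear B_V_p B_V_q flip: sum_unit)

lemma mult_V_p: "v \<in> V \<Longrightarrow> m v p = 0"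
  using mult_cj_polarized[of p v] by (simp add: cj_V cj_p B_p_V mult_linear mult_q_V)

lemma mult_V_q: "v \<in> V \<Longrightarrow> m v q = v"
  using unit_right[of v] unfolding sum_unit[symmetric] by (simp add: mult_linear mult_V_p)

lemma B_V_V:
  assumes "v \<in> V" "v' \<in> V" shows "B v v' = 0"
  using B_mult_left[of p v v'] assms by (simp add: mult_p_V isotropic_p)

text \<open>With \<open>u = p\<close> the polarised alternative law \<open>u\<^sup>\<sigma> (w z) + w\<^sup>\<sigma> (u z) = 2 (u, w) z\<close> shows that left
  multiplication by \<open>q\<close> fixes \<open>v v'\<close>.\<close>

lemma mult_V_V:
  assumes v: "v \<in> V" "v' \<in> V" shows "m v v' \<in> W"
proof -
  have "B p (m v v') = 0" "B q (m v v') = 0"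
    using B_mult_adjoint[of v v' p] B_mult_adjoint[of v v' q] v
    by (simp_all add: B_sym[of _ "m v v'"] cj_V mult_linear mult_V_p mult_V_q B_linear B_V_V)
  moreover have "m q (m v v') = m v v'"
    using left_cancel_polarized[of p v v'] v by (simp add: cj_p cj_V mult_linear mult_p_V B_p_V)
  ultimately show ?thesis by (simp add: peirce_space_def)
qed

lemma anticommute_V:
  assumes "v \<in> V" "v' \<in> V" shows "m v v' = - m v' v"
proof -
  have "m (cj v) v' + m (cj v') v = 0"
    using mult_cj_polarized[of v v'] assms by (simp add: B_V_V)
  then show ?thesis using assms by (simp add: cj_V mult_linear minus_equation_iff[of "m v v'"])
qed

lemma square_V: "v \<in> V \<Longrightarrow> m v v = 0"
  using left_cancel[of v e] B_V_V[of v v] by (simp add: cj_V mult_linear B_self)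

lemma p_mult_V_W:
  assumes v: "v \<in> V" and w: "w \<in> W" shows "m p (m v w) = m v w"
  using left_cancel_polarized[of q v w] v w
  by (simp add: cj_q cj_V mult_linear B_q_V peirce_space_def[of m N q p])

end

context peirce
begin

interpretation sw: peirce m e N q p by (rule swap)

lemmas mult_q_W = sw.mult_p_V and mult_p_W = sw.mult_q_V and mult_W_q = sw.mult_V_p
  and mult_W_p = sw.mult_V_q and cj_W = sw.cj_V and B_W_W = sw.B_V_V
  and B_p_W = sw.B_q_V and B_q_W = sw.B_p_V and B_W_p = sw.B_V_q and B_W_q = sw.B_V_p

text \<open>The sum \<open>v w + w v\<close> is a multiple of \<open>e\<close> because \<open>v\<close> and \<open>w\<close> are pure. Multiplication by \<open>p\<close> from the
  left keeps the first term and annihilates the second.\<close>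

lemma mult_V_W:
  assumes v: "v \<in> V" and w: "w \<in> W" shows "m v w = - (2 * B v w) *s p"
proof -
  have "- m v w - m w v = (2 * B v w) *s e"
    using mult_cj_polarized[of v w] v w by (simp add: cj_V cj_W mult_linear)
  then have "m v w + m w v = - (2 * B v w) *s e"
    by (metis (no_types) add.inverse_inverse minus_add_distrib vec.scale_minus_left diff_conv_add_uminus)
  then have "m p (m v w) + m p (m w v) = - (2 * B v w) *s p"
    by (simp flip: mult_add_right add: mult_linear)
  moreover have "m p (m w v) = 0"
    using sw.p_mult_V_W[OF w v] mult_p_q_left by metis
  ultimately show ?thesis using p_mult_V_W[OF v w] by simp
qed

end

context peirce
begin

interpretation sw: peirce m e N q p by (rule swap)

lemma mult_W_V:
  assumes "v \<in> V" "w \<in> W" shows "m w v = - (2 * B v w) *s q"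
  using sw.mult_V_W[OF assms(2,1)] by (simp add: B_sym)

lemma triple_cyclic:
  assumes "v1 \<in> V" "v2 \<in> V" "v3 \<in> V"
  shows "B (m v1 v2) v3 = B (m v2 v3) v1"
proof -
  have cyc: "B (m a b) c = B (m c a) b" if "a \<in> V" "b \<in> V" "c \<in> V" for a b c
    using B_mult_adjoint[of a b c] that anticommute_V[of a c]
    by (simp add: cj_V mult_linear B_sym)
  show ?thesis using assms by (simp add: cyc)
qed

text \<open>This is the formula for a vector triple product. It is the source of nonvanishing products: for
  \<open>w\<close> with \<open>(v, w) \<noteq> 0\<close> and \<open>(v', w) = 0\<close> it shows \<open>v v' \<noteq> 0\<close> as soon as \<open>v' \<noteq> 0\<close>.\<close>

lemma mult_W_VV:
  assumes v: "v \<in> V" "v' \<in> V" and w: "w \<in> W"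
  shows "m w (m v v') = (2 * B v' w) *s v - (2 * B v w) *s v'"
proof -
  have "m (cj v) (m w v') + m (cj w) (m v v') = (2 * B v w) *s v'"
    by (rule left_cancel_polarized)
  then have "- m v (m w v') - m w (m v v') = (2 * B v w) *s v'"
    using v w by (simp add: cj_V cj_W mult_linear)
  moreover have "m v (m w v') = - (2 * B v' w) *s v"
    using v w by (simp add: mult_W_V mult_linear mult_V_q)
  ultimately show ?thesis by (simp add: algebra_simps)
qed

lemma projections:
  assumes "B p y = 0" "B q y = 0"
  shows "m p y \<in> V" "m q y \<in> W"
proof -
  have "B p (m p y) = 0" "B q (m p y) = 0" "B p (m q y) = 0" "B q (m q y) = 0"
    using B_mult_adjoint[of p y p] B_mult_adjoint[of p y q] B_mult_adjoint[of q y p]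
      B_mult_adjoint[of q y q] assms
    by (simp_all add: cj_p cj_q B_sym[of _ "m _ _"] mult_qp mult_qq mult_pp mult_pq B_linear B_sym[of y])
  moreover have "m p (m p y) = m p y" "m q (m q y) = m q y"
    using split_vector[of "m p y"] split_vector[of "m q y"] mult_q_p_left mult_p_q_left by simp_all
  ultimately show "m p y \<in> V" "m q y \<in> W" by (simp_all add: peirce_space_def)
qed

text \<open>The vectors \<open>v1 = p y\<close> and \<open>v2 = p z\<close> come from anisotropic \<open>y\<close> and \<open>z\<close> such that \<open>z\<close> is orthogonal to
  the quaternion algebra containing \<open>p\<close>, \<open>q\<close> and \<open>y\<close>. The vector triple product with \<open>w = q y\<close> gives
  \<open>v1 v2 \<noteq> 0\<close>. Since \<open>v1 v2\<close> lies in \<open>W\<close>, it pairs nontrivially with a vector of \<open>V\<close>, which can be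
  rescaled to make the value \<open>1\<close>.\<close>

lemma V_triple_exists:
  obtains v1 v2 v3 where "v1 \<in> V" "v2 \<in> V" "v3 \<in> V" "2 * B (m v1 v2) v3 = 1"
proof -
  define d where "d = p - q"
  have d: "B e d = 0" "N d \<noteq> 0"
    by (simp_all add: d_def B_linear B_pp B_qq B_pq B_qp flip: sum_unit B_self)
  obtain y where y: "N y \<noteq> 0" "B e y = 0" "B d y = 0"
    using orthogonal_to_pure_exists[OF d] by blast
  obtain z where z: "N z \<noteq> 0" "B e z = 0" "B d z = 0" "B y z = 0" "B (m d y) z = 0"
    using orthogonal_to_quaternions_exists[OF d y(2,3,1)] by blast
  have orth: "B p u = 0 \<and> B q u = 0" if "B e u = 0" "B d u = 0" for u
    using that by (simp add: d_def B_linear flip: sum_unit)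
  have NB: "N u = 2 * B (m p u) (m q u)" for u
    using N_add[of "m p u" "m q u"] by (simp add: split_vector N_mult isotropic_p isotropic_q)
  have y': "m p y \<in> V" "m q y \<in> W" and z': "m p z \<in> V" "m q z \<in> W"
    using projections orth y z by simp_all
  have yz: "B (m p z) (m q y) = 0"
  proof -
    have "B (m p z) (m q y) = B z (m q y)"
      using B_mult_adjoint[of p z "m q y"] y'(2) by (simp add: cj_p mult_q_W)
    moreover have "m q y + m q y = y - m d y"
      using split_vector[of y] by (simp add: d_def mult_linear algebra_simps)
    then have "B z (m q y) + B z (m q y) = B z (y - m d y)" by (simp flip: B_add_right)
    then have "B z (m q y) = 0" using z by (simp add: B_linear B_sym[of z])
    ultimately show ?thesis by simp
  qed
  have "m (m q y) (m (m p y) (m p z)) = - (2 * B (m p y) (m q y)) *s m p z"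
    using mult_W_VV[OF y'(1) z'(1) y'(2)] by (simp add: yz)
  moreover have "m p z \<noteq> 0" using NB[of z] z(1) by (auto simp: B_linear)
  ultimately have "m (m p y) (m p z) \<noteq> 0"
    using NB[of y] y(1) by (auto simp: mult_linear)
  then obtain u where u: "B (m (m p y) (m p z)) u \<noteq> 0" using nondegenerate by metis
  define c where "c = m (m p y) (m p z)"
  have c: "c \<in> W" unfolding c_def using y'(1) z'(1) by (rule mult_V_V)
  define u' where "u' = u - (2 * B q u) *s p - (2 * B p u) *s q"
  have "B p u' = 0" "B q u' = 0" by (simp_all add: u'_def B_linear B_pp B_qq B_pq B_qp)
  then have "m p u' \<in> V" by (rule projections)
  moreover have "B c (m p u') = B c u"
    using B_mult_adjoint[of q c u'] c
    by (simp add: cj_q mult_q_W) (simp add: u'_def B_linear B_W_p B_W_q)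
  ultimately have "2 * B c ((1 / (2 * B c u)) *s m p u') = 1"
      "(1 / (2 * B c u)) *s m p u' \<in> V"
    using u by (simp_all add: c_def B_linear) (simp add: peirce_space_def B_linear mult_linear)
  then show thesis using that[OF y'(1) z'(1)] unfolding c_def by blast
qed

end

section \<open>Cross products and the cofactor matrix in dimension three\<close>

definition cross :: "'a::comm_ring_1^3 \<Rightarrow> 'a^3 \<Rightarrow> 'a^3" where
  "cross a b = vector [a$2 * b$3 - a$3 * b$2, a$3 * b$1 - a$1 * b$3, a$1 * b$2 - a$2 * b$1]"

definition dot :: "'a::comm_ring_1^3 \<Rightarrow> 'a^3 \<Rightarrow> 'a" where
  "dot a b = a$1 * b$1 + a$2 * b$2 + a$3 * b$3"

lemma cross_component [simp]:
  "cross a b $ 1 = a$2 * b$3 - a$3 * b$2"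
  "cross a b $ 2 = a$3 * b$1 - a$1 * b$3"
  "cross a b $ 3 = a$1 * b$2 - a$2 * b$1"
  by (simp_all add: cross_def)

text \<open>The rows of the cofactor matrix are the cross products of the rows of \<open>h\<close>. For \<open>det h = 1\<close> it is the
  inverse transpose of \<open>h\<close>, that is, the action on the dual space, in a manifestly polynomial form.\<close>

definition cof3 :: "'a::comm_ring_1^3^3 \<Rightarrow> 'a^3^3" where
  "cof3 h = vector [cross (h$2) (h$3), cross (h$3) (h$1), cross (h$1) (h$2)]"

lemma cof3_component [simp]:
  "cof3 h $ 1 = cross (h$2) (h$3)" "cof3 h $ 2 = cross (h$3) (h$1)" "cof3 h $ 3 = cross (h$1) (h$2)"
  by (simp_all add: cof3_def)

lemmas expand3 = matrix_vector_mult_def sum_3 dot_def det_3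

lemma cof3_mult_cross: "cof3 h *v cross a b = cross (h *v a) (h *v b)"
  by (simp add: vec_eq_iff forall_3 expand3 algebra_simps)

lemma dot_mult_cof3: "dot (h *v a) (cof3 h *v b) = det h * dot a b"
  by (simp add: expand3 algebra_simps)

lemma cross_mult_cof3: "cross (cof3 h *v a) (cof3 h *v b) = det h *s (h *v cross a b)"
  by (simp add: vec_eq_iff forall_3 expand3) (simp add: algebra_simps)

lemma dot_commute: "dot a b = dot b a"
  by (simp add: dot_def mult.commute)

lemma dot_zero: "dot 0 a = 0" "dot a 0 = 0"
  by (simp_all add: dot_def)

lemma cross_zero: "cross 0 a = 0" "cross a 0 = 0"
  by (simp_all add: vec_eq_iff forall_3)

lemma cross_axis:
  "cross (axis 2 1) (axis 3 1) = axis 1 1" "cross (axis 3 1) (axis 1 1) = axis 2 1"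
  "cross (axis 1 1) (axis 2 1) = axis 3 1"
  by (simp_all add: vec_eq_iff forall_3 axis_def)

text \<open>Every vector of a three-dimensional space is a sum of cross products, so a matrix is
  determined by its values on these.\<close>

lemma matrix_eq_on_cross:
  fixes g h :: "'a::field^3^3"
  assumes "\<And>a b. g *v cross a b = h *v cross a b"
  shows "g = h"
proof -
  have "g *v axis i 1 = h *v axis i 1" for i
    using exhaust_3[of i] assms[of "axis 2 1" "axis 3 1"] assms[of "axis 3 1" "axis 1 1"]
      assms[of "axis 1 1" "axis 2 1"] by (auto simp: cross_axis)
  moreover have "(M *v axis j 1) $ i = M $ i $ j" for M :: "'a^3^3" and i j
    by (simp add: matrix_vector_mult_def axis_def if_distrib cong: if_cong)
  ultimately show ?thesis by (metis vec_eq_iff)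
qed

lemma cof3_mult: "cof3 (g ** h) = cof3 g ** cof3 h" for g h :: "'a::field^3^3"
  by (rule matrix_eq_on_cross) (simp add: cof3_mult_cross flip: matrix_vector_mul_assoc)

lemma cof3_mat1: "cof3 (mat 1) = (mat 1 :: 'a::field^3^3)"
  by (rule matrix_eq_on_cross) (simp add: cof3_mult_cross)

section \<open>Zorn coordinates\<close>

text \<open>The three vectors generate the whole algebra. With \<open>w1, w2, w3\<close> their pairwise products, the
  vectors \<open>v1, v2, v3\<close> and \<open>w1, w2, w3\<close> turn out to be dual bases of \<open>V\<close> and \<open>W\<close> with respect to twice the
  bilinear form, and the multiplication takes the form of Zorn's vector matrices.\<close>

locale zorn_frame = peirce m e N p q
  for m :: "'k::field_char_0^8 \<Rightarrow> 'k^8 \<Rightarrow> 'k^8" and e N p q +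
  fixes v1 v2 v3
  assumes v_mem: "v1 \<in> V" "v2 \<in> V" "v3 \<in> V" and triple: "2 * B (m v1 v2) v3 = 1"
begin

definition "w1 = m v2 v3"
definition "w2 = m v3 v1"
definition "w3 = m v1 v2"

lemma w_mem: "w1 \<in> W" "w2 \<in> W" "w3 \<in> W"
  by (simp_all add: w1_def w2_def w3_def mult_V_V v_mem)

lemma mult_vv:
  "m v1 v1 = 0" "m v2 v2 = 0" "m v3 v3 = 0"
  "m v1 v2 = w3" "m v2 v3 = w1" "m v3 v1 = w2"
  "m v2 v1 = - w3" "m v3 v2 = - w1" "m v1 v3 = - w2"
  using anticommute_V[of v2 v1] anticommute_V[of v3 v2] anticommute_V[of v1 v3]
  by (simp_all add: square_V v_mem w1_def w2_def w3_def)

lemma B_vw: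
  "B v1 w1 = 1/2" "B v2 w2 = 1/2" "B v3 w3 = 1/2"
  "B v1 w2 = 0" "B v1 w3 = 0" "B v2 w1 = 0" "B v2 w3 = 0" "B v3 w1 = 0" "B v3 w2 = 0"
proof -
  show "B v1 w1 = 1/2" "B v2 w2 = 1/2" "B v3 w3 = 1/2"
    using triple triple_cyclic[of v1 v2 v3] triple_cyclic[of v2 v3 v1]
    by (simp_all add: v_mem w1_def w2_def w3_def B_sym[of v1] B_sym[of v2] B_sym[of v3] field_simps)
  have "B (m v v') v = 0" "B (m v v') v' = 0" if "v \<in> V" "v' \<in> V" for v v'
    using B_mult_left[of v v' e] B_mult_right[of v v' e] that B_V_V[of v v] B_V_V[of v' v']
    by (simp_all add: B_self)
  then show "B v1 w2 = 0" "B v1 w3 = 0" "B v2 w1 = 0" "B v2 w3 = 0" "B v3 w1 = 0" "B v3 w2 = 0"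
    by (simp_all add: v_mem w1_def w2_def w3_def B_sym[of v1] B_sym[of v2] B_sym[of v3])
qed

lemma mult_w1_w2: "m w1 w2 = v3" and mult_w2_w3: "m w2 w3 = v1" and mult_w3_w1: "m w3 w1 = v2"
  using mult_W_VV[of v3 v1 w1] mult_W_VV[of v1 v2 w2] mult_W_VV[of v2 v3 w3]
  by (simp_all add: v_mem w_mem mult_vv B_vw)

text \<open>Since \<open>w1 w2 = v3\<close> and cyclically, the \<open>w\<close> form a frame for the exchanged idempotents, whose own
  products are the original \<open>v\<close>.\<close>

lemma swap_frame: "zorn_frame m e N q p w1 w2 w3"
proof -
  interpret sw: peirce m e N q p by (rule swap)
  show ?thesis
    by unfold_locales (simp_all add: w_mem mult_w1_w2 B_vw)
qed

end

context zorn_frame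
begin

interpretation sw: zorn_frame m e N q p w1 w2 w3 by (rule swap_frame)

lemma sw_w: "sw.w1 = v1" "sw.w2 = v2" "sw.w3 = v3"
  by (simp_all add: sw.w1_def sw.w2_def sw.w3_def mult_w1_w2 mult_w2_w3 mult_w3_w1)

lemmas mult_ww = sw.mult_vv[unfolded sw_w]

text \<open>A vector \<open>v\<close> of \<open>V\<close> orthogonal to all \<open>w\<close> has \<open>v v1 = v (w2 w3) = 0\<close> by the vector triple product.
  The same formula for \<open>w1 (v v1)\<close> returns \<open>v\<close>, so \<open>v = 0\<close>. This shows that \<open>v1, v2, v3\<close> span \<open>V\<close>
  without counting dimensions.\<close>

lemma V_orthogonal_zero:
  assumes v: "v \<in> V" and orth: "B v w1 = 0" "B v w2 = 0" "B v w3 = 0"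
  shows "v = 0"
proof -
  have "m v v1 = 0"
    using sw.mult_W_VV[of w2 w3 v] v orth by (simp add: w_mem mult_ww B_sym[of _ v])
  moreover have "m w1 (m v v1) = v"
    using mult_W_VV[of v v1 w1] v orth by (simp add: v_mem w_mem B_vw)
  ultimately show ?thesis by (simp add: mult_linear)
qed

definition vemb :: "'k^3 \<Rightarrow> 'k^8" where
  "vemb a = a$1 *s v1 + a$2 *s v2 + a$3 *s v3"

definition wemb :: "'k^3 \<Rightarrow> 'k^8" where
  "wemb a = a$1 *s w1 + a$2 *s w2 + a$3 *s w3"

definition vco :: "'k^8 \<Rightarrow> 'k^3" where
  "vco u = vector [2 * B w1 u, 2 * B w2 u, 2 * B w3 u]"

definition wco :: "'k^8 \<Rightarrow> 'k^3" where
  "wco u = vector [2 * B v1 u, 2 * B v2 u, 2 * B v3 u]"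

lemma vco_component [simp]:
  "vco u $ 1 = 2 * B w1 u" "vco u $ 2 = 2 * B w2 u" "vco u $ 3 = 2 * B w3 u"
  by (simp_all add: vco_def)

lemma wco_component [simp]:
  "wco u $ 1 = 2 * B v1 u" "wco u $ 2 = 2 * B v2 u" "wco u $ 3 = 2 * B v3 u"
  by (simp_all add: wco_def)

lemma vemb_add: "vemb (a + b) = vemb a + vemb b" and vemb_scale: "vemb (c *s a) = c *s vemb a"
  and wemb_add: "wemb (a + b) = wemb a + wemb b" and wemb_scale: "wemb (c *s a) = c *s wemb a"
  by (simp_all add: vemb_def wemb_def algebra_simps vec.scale_left_distrib vec.scale_right_distrib)

lemma vemb_mem: "vemb a \<in> V"
  using v_mem by (simp add: vemb_def peirce_space_def mult_linear B_linear)

lemma wemb_mem: "wemb a \<in> W"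
  using w_mem by (simp add: wemb_def peirce_space_def mult_linear B_linear)

lemma B_wv: "B w1 v1 = 1/2" "B w2 v2 = 1/2" "B w3 v3 = 1/2"
  "B w2 v1 = 0" "B w3 v1 = 0" "B w1 v2 = 0" "B w3 v2 = 0" "B w1 v3 = 0" "B w2 v3 = 0"
  using B_vw by (simp_all add: B_sym)

lemma vco_vemb: "vco (vemb a) = a"
  by (simp add: vec_eq_iff forall_3 vemb_def B_linear B_wv)

lemma V_eq_vemb:
  assumes "v \<in> V" shows "vemb (vco v) = v"
proof -
  have "v - vemb (vco v) \<in> V"
    using assms vemb_mem[of "vco v"] by (simp add: peirce_space_def mult_linear B_linear)
  then have "v - vemb (vco v) = 0"
    by (rule V_orthogonal_zero) (simp_all add: vemb_def B_linear B_vw B_sym[of v])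
  then show ?thesis by simp
qed

lemma vemb_mult_vemb: "m (vemb a) (vemb b) = wemb (cross a b)"
  by (simp add: vemb_def wemb_def mult_linear mult_vv vec.scale_left_diff_distrib
      vec.scale_right_distrib algebra_simps)

lemma vemb_mult_wemb: "m (vemb a) (wemb b) = - dot a b *s p"
  by (subst mult_V_W[OF vemb_mem wemb_mem])
    (simp add: vemb_def wemb_def B_linear B_vw dot_def algebra_simps)

lemma wemb_mult_vemb: "m (wemb a) (vemb b) = - dot a b *s q"
  by (subst mult_W_V[OF vemb_mem wemb_mem])
    (simp add: vemb_def wemb_def B_linear B_vw dot_def algebra_simps)

end

context zorn_frame
begin

interpretation sw: zorn_frame m e N q p w1 w2 w3 by (rule swap_frame)

lemma sw_emb: "sw.vemb = wemb" "sw.wemb = vemb" "sw.vco = wco" "sw.wco = vco"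
  by (simp_all add: fun_eq_iff sw.vemb_def sw.wemb_def sw.vco_def sw.wco_def sw_w
      vemb_def wemb_def vco_def wco_def)

lemmas wco_wemb = sw.vco_vemb[unfolded sw_emb]
lemmas W_eq_wemb = sw.V_eq_vemb[unfolded sw_emb]
lemmas wemb_mult_wemb = sw.vemb_mult_vemb[unfolded sw_emb]

text \<open>This is the vector matrix with diagonal entries \<open>a\<close>, \<open>b\<close> and off-diagonal entries \<open>v\<close>, \<open>w\<close>.\<close>

definition zorn :: "'k \<Rightarrow> 'k^3 \<Rightarrow> 'k^3 \<Rightarrow> 'k \<Rightarrow> 'k^8" where
  "zorn a v w b = a *s p + vemb v + wemb w + b *s q"

theorem zorn_mult:
  "m (zorn a v w b) (zorn a' v' w' b') =
    zorn (a * a' - dot v w') (a *s v' + b' *s v + cross w w')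
      (a' *s w + b *s w' + cross v v') (b * b' - dot w v')"
  by (simp add: zorn_def mult_linear mult_pp mult_qq mult_pq mult_qp
      vemb_mem[THEN mult_p_V] vemb_mem[THEN mult_q_V] vemb_mem[THEN mult_V_p] vemb_mem[THEN mult_V_q]
      wemb_mem[THEN mult_p_W] wemb_mem[THEN mult_q_W] wemb_mem[THEN mult_W_p] wemb_mem[THEN mult_W_q]
      vemb_mult_vemb vemb_mult_wemb wemb_mult_vemb wemb_mult_wemb
      vemb_add wemb_add vemb_scale wemb_scale vec.scale_left_diff_distrib vec.scale_right_distrib
      algebra_simps)

lemma zorn_coordinates:
  "2 * B q (zorn a v w b) = a" "vco (zorn a v w b) = v"
  "wco (zorn a v w b) = w" "2 * B p (zorn a v w b) = b"
proof -
  have "vco (x + y) = vco x + vco y" "wco (x + y) = wco x + wco y" for x y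
    by (simp_all add: vec_eq_iff forall_3 B_linear distrib_left)
  moreover have "vco (wemb x) = 0" "wco (vemb x) = 0" "vco (c *s p) = 0" "vco (c *s q) = 0"
      "wco (c *s p) = 0" "wco (c *s q) = 0" for x c
    by (simp_all add: vec_eq_iff forall_3 B_linear B_V_V B_W_W vemb_mem wemb_mem v_mem w_mem
        B_V_p B_V_q B_W_p B_W_q)
  ultimately show "vco (zorn a v w b) = v" "wco (zorn a v w b) = w"
    by (simp_all add: zorn_def vco_vemb wco_wemb)
  show "2 * B q (zorn a v w b) = a" "2 * B p (zorn a v w b) = b"
    by (simp_all add: zorn_def B_linear B_pp B_qq B_pq B_qp vemb_mem[THEN B_p_V] vemb_mem[THEN B_q_V]
        wemb_mem[THEN B_p_W] wemb_mem[THEN B_q_W])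
qed

text \<open>After removal of its components along \<open>p\<close> and \<open>q\<close> a vector splits into a part in \<open>V\<close> and a part in
  \<open>W\<close>, and the frame spans both.\<close>

theorem zorn_expansion: "zorn (2 * B q u) (vco u) (wco u) (2 * B p u) = u"
proof -
  define r where "r = u - (2 * B q u) *s p - (2 * B p u) *s q"
  have "B p r = 0" "B q r = 0" by (simp_all add: r_def B_linear B_pp B_qq B_pq B_qp)
  note mem = projections[OF this]
  have "B w (m p r) = B w u" if "w \<in> W" for w
    using B_mult_adjoint[of q w r] that by (simp add: cj_q mult_q_W r_def B_linear B_W_p B_W_q)
  then have "vco (m p r) = vco u" by (simp add: vec_eq_iff forall_3 w_mem)
  moreover have "B v (m q r) = B v u" if "v \<in> V" for v
    using B_mult_adjoint[of p v r] that by (simp add: cj_p mult_p_V r_def B_linear B_V_p B_V_q)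
  then have "wco (m q r) = wco u" by (simp add: vec_eq_iff forall_3 v_mem)
  ultimately have "vemb (vco u) = m p r" "wemb (wco u) = m q r"
    using V_eq_vemb[OF mem(1)] W_eq_wemb[OF mem(2)] by simp_all
  then have "vemb (vco u) + wemb (wco u) = r" by (simp add: split_vector)
  then show ?thesis by (simp add: zorn_def r_def algebra_simps)
qed

end

section \<open>Regular functions\<close>

lemma regular_sum:
  "0 \<in> K \<Longrightarrow> (\<And>i. i \<in> I \<Longrightarrow> f i \<in> regular_functions K) \<Longrightarrow>
    (\<lambda>g. \<Sum>i\<in>I. f i g) \<in> regular_functions K"
  by (induction I rule: infinite_finite_induct) (auto intro: regular_functions.intros)

lemma regular_diff:
  assumes "-1 \<in> K" "p \<in> regular_functions K" "q \<in> regular_functions K"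
  shows "(\<lambda>g. p g - q g) \<in> regular_functions K"
proof -
  have "(\<lambda>g. p g + (-1) * q g) \<in> regular_functions K"
    using assms by (intro regular_functions.intros)
  then show ?thesis by simp
qed

section \<open>The stabilizer as a special linear group\<close>

definition real_points :: "(complex^'n) set" where
  "real_points = {u. \<forall>i. u $ i \<in> \<real>}"

text \<open>A complex octonion algebra with a real structure: the frame is real, and real points are closed
  under multiplication and have real inner products.\<close>

locale real_zorn_frame = zorn_frame m e N p q v1 v2 v3
  for m :: "complex^8 \<Rightarrow> complex^8 \<Rightarrow> complex^8" and e N p q v1 v2 v3 +
  assumes real_mult: "u \<in> real_points \<Longrightarrow> v \<in> real_points \<Longrightarrow> m u v \<in> real_points"
    and real_B: "u \<in> real_points \<Longrightarrow> v \<in> real_points \<Longrightarrow> bform N u v \<in> \<real>"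
    and real_frame: "p \<in> real_points" "q \<in> real_points"
      "v1 \<in> real_points" "v2 \<in> real_points" "v3 \<in> real_points"
begin

lemma real_w: "w1 \<in> real_points" "w2 \<in> real_points" "w3 \<in> real_points"
  by (simp_all add: w1_def w2_def w3_def real_mult real_frame)

text \<open>The element \<open>p - q\<close> is orthogonal to \<open>e\<close> and has square \<open>e\<close>; in the application it is a real multiple
  of \<open>x\<close>.\<close>

definition stab :: "(complex^8^8) set" where
  "stab = {g \<in> aut_group m. g *v (p - q) = p - q}"

definition act :: "complex^3^3 \<Rightarrow> complex^8 \<Rightarrow> complex^8" where
  "act h u = zorn (2 * B q u) (h *v vco u) (cof3 h *v wco u) (2 * B p u)"

definition lift :: "complex^3^3 \<Rightarrow> complex^8^8" where
  "lift h = matrix (act h)"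

definition restr :: "complex^8^8 \<Rightarrow> complex^3^3" where
  "restr g = matrix (\<lambda>a. vco (g *v vemb a))"

lemma vco_add: "vco (x + y) = vco x + vco y" and vco_scale: "vco (c *s x) = c *s vco x"
  and wco_add: "wco (x + y) = wco x + wco y" and wco_scale: "wco (c *s x) = c *s wco x"
  by (simp_all add: vec_eq_iff forall_3 B_linear distrib_left)

lemma vemb_zero: "vemb 0 = 0" and wemb_zero: "wemb 0 = 0"
  by (simp_all add: vemb_def wemb_def)

lemma zorn_add: "zorn a v w b + zorn a' v' w' b' = zorn (a + a') (v + v') (w + w') (b + b')"
  by (simp add: zorn_def vemb_add wemb_add vec.scale_left_distrib)

lemma zorn_scale: "c *s zorn a v w b = zorn (c * a) (c *s v) (c *s w) (c * b)"
  by (simp add: zorn_def vemb_scale wemb_scale vec.scale_right_distrib)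

lemma zorn_special:
  "zorn 1 0 0 0 = p" "zorn 0 0 0 1 = q" "zorn 0 a 0 0 = vemb a" "zorn 0 0 a 0 = wemb a"
  "zorn 1 0 0 (-1) = p - q" "zorn 0 0 0 0 = 0"
  by (simp_all add: zorn_def vemb_zero wemb_zero)

lemma zorn_p_q_mult:
  "m p (zorn a v w b) = zorn a v 0 0" "m (zorn a v w b) p = zorn a 0 w 0"
  "m q (zorn a v w b) = zorn 0 0 w b" "m (zorn a v w b) q = zorn 0 v 0 b"
  using zorn_mult[of 1 0 0 0 a v w b] zorn_mult[of a v w b 1 0 0 0]
    zorn_mult[of 0 0 0 1 a v w b] zorn_mult[of a v w b 0 0 0 1]
  by (simp_all add: zorn_special dot_zero cross_zero)

lemma zorn_eq_iff: "zorn a v w b = zorn a' v' w' b' \<longleftrightarrow> a = a' \<and> v = v' \<and> w = w' \<and> b = b'"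
  using zorn_coordinates by metis

lemma act_zorn: "act h (zorn a v w b) = zorn a (h *v v) (cof3 h *v w) b"
  by (simp only: act_def zorn_coordinates)

lemma act_linear: "Vector_Spaces.linear (*s) (*s) (act h)"
  unfolding Vector_Spaces.linear_iff
  by (simp add: vec.vector_space_axioms act_def B_linear vco_add vco_scale wco_add wco_scale
      matrix_vector_right_distrib vector_scalar_commute zorn_add zorn_scale distrib_left mult_ac)

lemma lift_apply: "lift h *v u = act h u"
  unfolding lift_def by (rule matrix_works[OF act_linear])

lemma restr_apply: "restr g *v a = vco (g *v vemb a)"
  unfolding restr_def
  by (rule matrix_works) (simp add: Vector_Spaces.linear_iff vec.vector_space_axioms vemb_add
      vemb_scale matrix_vector_right_distrib vector_scalar_commute vco_add vco_scale)

lemma lift_mult: "lift (g ** h) = lift g ** lift h"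
proof -
  have "act (g ** h) u = act g (act h u)" for u
    by (subst (1 2) zorn_expansion[of u, symmetric], simp only: act_zorn)
      (simp add: cof3_mult matrix_vector_mul_assoc)
  then show ?thesis by (simp add: matrix_eq lift_apply flip: matrix_vector_mul_assoc)
qed

lemma lift_mat1: "lift (mat 1) = mat 1"
  by (simp add: matrix_eq lift_apply act_def cof3_mat1 zorn_expansion)

text \<open>In Zorn coordinates the multiplication is built from scalar products of \<open>V\<close> with \<open>W\<close> and from the
  two cross products. For \<open>det h = 1\<close> the pair \<open>h\<close>, \<open>cof3 h\<close> respects all of them.\<close>

lemma act_mult:
  assumes "det h = 1"
  shows "act h (m u u') = m (act h u) (act h u')"
proof -
  obtain a v w b a' v' w' b' where u: "u = zorn a v w b" "u' = zorn a' v' w' b'"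
    using zorn_expansion by metis
  show ?thesis
    using assms dot_mult_cof3[of h v' w]
    by (simp add: u zorn_mult act_zorn zorn_eq_iff dot_mult_cof3 cof3_mult_cross cross_mult_cof3
        matrix_vector_right_distrib vector_scalar_commute dot_commute[of w] dot_commute[of "cof3 h *v w"])
qed

lemma lift_in_stab:
  assumes "h \<in> SL3"
  shows "lift h \<in> stab"
proof -
  have det: "det h = 1" using assms by (simp add: SL3_def)
  then have "invertible h" by (simp add: invertible_det_nz)
  then obtain h' where "h ** h' = mat 1" "h' ** h = mat 1" by (auto simp: invertible_def)
  then have "lift h ** lift h' = mat 1" "lift h' ** lift h = mat 1"
    by (simp_all add: lift_mat1 flip: lift_mult)
  then have "invertible (lift h)" by (auto simp: invertible_def)
  moreover have "lift h *v (p - q) = p - q"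
    using act_zorn[of h 1 0 0 "-1"] by (simp add: lift_apply zorn_special)
  ultimately show ?thesis
    by (simp add: stab_def aut_group_def lift_apply act_mult[OF det])
qed

lemma restr_lift: "restr (lift h) = h"
  by (simp add: matrix_eq restr_apply lift_apply act_zorn zorn_coordinates flip: zorn_special(3))

lemma stab_frame:
  assumes g: "g \<in> stab"
  shows "g *v p = p" "g *v q = q"
proof -
  obtain g' where g': "g ** g' = mat 1" using g by (auto simp: stab_def aut_group_def invertible_def)
  have mult: "g *v m u v = m (g *v u) (g *v v)" for u v using g by (simp add: stab_def aut_group_def)
  have "m (g *v e) e = e"
    using mult[of e "g' *v e"] g' by (simp add: matrix_vector_mul_assoc)
  then have sum: "g *v p + g *v q = p + q"
    by (simp add: sum_unit flip: matrix_vector_right_distrib)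
  have diff: "g *v p - g *v q = p - q"
    using g by (simp add: stab_def matrix_vector_mult_diff_distrib)
  have "2 *s (g *v p) = 2 *s p" "2 *s (g *v q) = 2 *s q"
    using arg_cong2[OF sum diff, of "(+)"] arg_cong2[OF sum diff, of "(-)"]
    by (simp_all add: vec_eq_iff)
  then show "g *v p = p" "g *v q = q" by simp_all
qed

text \<open>An automorphism fixing \<open>p\<close> and \<open>q\<close> preserves the spaces \<open>V\<close> and \<open>W\<close>, which are cut out by
  multiplication with \<open>p\<close> and \<open>q\<close>. It acts on them by \<open>h\<close> and by some \<open>h'\<close>. The product of two vectors of
  \<open>V\<close> is their cross product in \<open>W\<close>, which forces \<open>h'\<close> to be the cofactor matrix of \<open>h\<close>; the
  products between \<open>V\<close> and \<open>W\<close> then force \<open>det h = 1\<close>.\<close>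

lemma stab_structure:
  assumes g: "g \<in> stab"
  shows "restr g \<in> SL3" "g *v u = act (restr g) u"
proof -
  have mult: "g *v m u v = m (g *v u) (g *v v)" for u v using g by (simp add: stab_def aut_group_def)
  note frame = stab_frame[OF g]
  define h where "h = restr g"
  have V: "g *v vemb a = vemb (h *v a)" for a
  proof -
    obtain \<alpha> v w \<beta> where u: "g *v vemb a = zorn \<alpha> v w \<beta>" using zorn_expansion by metis
    have "m p (zorn \<alpha> v w \<beta>) = zorn \<alpha> v w \<beta>" "m (zorn \<alpha> v w \<beta>) p = 0"
      using mult[of p "vemb a"] mult[of "vemb a" p] vemb_mem[of a]
      by (simp_all add: frame u mult_p_V mult_V_p)
    then have "zorn \<alpha> v w \<beta> = zorn \<alpha> v 0 0"
      "zorn \<alpha> 0 w 0 = zorn 0 0 0 0"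
      by (simp_all add: zorn_p_q_mult zorn_special(6))
    then have "w = 0" "\<beta> = 0" "\<alpha> = 0"
      by (simp_all add: zorn_eq_iff)
    then have "g *v vemb a = vemb v" using u by (simp add: zorn_special)
    then show ?thesis by (simp add: h_def restr_apply vco_vemb)
  qed
  have W: "g *v wemb a = wemb (wco (g *v wemb a))" for a
  proof -
    obtain \<alpha> v w \<beta> where u: "g *v wemb a = zorn \<alpha> v w \<beta>" using zorn_expansion by metis
    have "m q (zorn \<alpha> v w \<beta>) = zorn \<alpha> v w \<beta>" "m (zorn \<alpha> v w \<beta>) q = 0"
      using mult[of q "wemb a"] mult[of "wemb a" q] wemb_mem[of a]
      by (simp_all add: frame u mult_q_W mult_W_q)
    then have "zorn \<alpha> v w \<beta> = zorn 0 0 w \<beta>"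
      "zorn 0 v 0 \<beta> = zorn 0 0 0 0"
      by (simp_all add: zorn_p_q_mult zorn_special(6))
    then have "v = 0" "\<beta> = 0" "\<alpha> = 0"
      by (simp_all add: zorn_eq_iff)
    then have "g *v wemb a = wemb w" using u by (simp add: zorn_special)
    then show ?thesis by (simp add: wco_wemb)
  qed
  define h' where "h' = matrix (\<lambda>a. wco (g *v wemb a))"
  have "h' *v a = wco (g *v wemb a)" for a
    unfolding h'_def
    by (rule matrix_works) (simp add: Vector_Spaces.linear_iff vec.vector_space_axioms wemb_add
        wemb_scale matrix_vector_right_distrib vector_scalar_commute wco_add wco_scale)
  then have W: "g *v wemb a = wemb (h' *v a)" for a using W by simp
  have "h' *v cross a b = cross (h *v a) (h *v b)" for a b
  proof -
    have "wemb (h' *v cross a b) = wemb (cross (h *v a) (h *v b))"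
      using mult[of "vemb a" "vemb b"] by (simp add: vemb_mult_vemb V W)
    then show ?thesis by (metis wco_wemb)
  qed
  then have h': "h' = cof3 h"
    by (intro matrix_eq_on_cross) (simp add: cof3_mult_cross)
  have "dot (h *v a) (h' *v b) = dot a b" for a b
  proof -
    have "(dot (h *v a) (h' *v b)) *s p = dot a b *s p"
      using mult[of "vemb a" "wemb b"] vector_scalar_commute[of g "-1" "dot a b *s p"]
      by (simp add: vemb_mult_wemb V W frame vector_scalar_commute)
    then have "B q (dot (h *v a) (h' *v b) *s p) = B q (dot a b *s p)" by (simp only:)
    then show ?thesis by (simp add: B_linear B_qp)
  qed
  from this[of "axis 1 1" "axis 1 1"] have "det h = 1"
    unfolding h' dot_mult_cof3 by (simp add: dot_def axis_def)
  then show "restr g \<in> SL3" by (simp add: SL3_def h_def)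
  obtain a v w b where u: "u = zorn a v w b" using zorn_expansion by metis
  have "g *v u = a *s p + vemb (h *v v) + wemb (h' *v w) + b *s q"
    by (simp add: u zorn_def matrix_vector_right_distrib vector_scalar_commute frame V W)
  then show "g *v u = act (restr g) u"
    by (simp only: u act_zorn flip: zorn_def h_def h')
qed

lemma lift_restr: "g \<in> stab \<Longrightarrow> lift (restr g) = g"
  by (simp add: matrix_eq lift_apply stab_structure(2))

lemma restr_mult:
  assumes "g \<in> stab" "g' \<in> stab"
  shows "restr (g ** g') = restr g ** restr g'"
proof -
  have "restr (g ** g') = restr (lift (restr g) ** lift (restr g'))" by (simp add: lift_restr assms)
  also have "\<dots> = restr g ** restr g'" by (simp add: restr_lift flip: lift_mult)
  finally show ?thesis .
qed

text \<open>In the standard basis the coefficients of \<open>restr\<close> and \<open>lift\<close> are coordinates of real vectors and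
  values of the bilinear form on them, hence real.\<close>

lemma regular_coordinate:
  assumes "c \<in> real_points" "d \<in> real_points"
  shows "(\<lambda>g. 2 * B c (g *v d)) \<in> regular_functions \<real>"
proof -
  have "2 * B c (g *v d) = (\<Sum>k\<in>UNIV. \<Sum>l\<in>UNIV. 2 * B c (axis k 1) * d $ l * g $ k $ l)" for g
  proof -
    have "B c (g *v d) = B c (\<Sum>k\<in>UNIV. (g *v d) $ k *s axis k 1)" by (simp only: basis_expansion)
    then show ?thesis
      by (simp add: B_sum_right B_linear matrix_vector_mult_def sum_distrib_left sum_distrib_right mult_ac)
  qed
  moreover have "axis k 1 \<in> real_points" for k :: 8 by (simp add: real_points_def axis_def)
  ultimately show ?thesis
    using assms by (auto simp: real_points_def intro!: regular_sum regular_functions.intros real_B Reals_mult)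
qed

lemma regular_restr: "\<exists>f\<in>regular_functions \<real>. \<forall>g\<in>stab. restr g $ i $ j = f g"
proof -
  have real: "vemb (axis j 1) \<in> real_points"
    using real_frame by (auto simp: vemb_def real_points_def axis_def)
  have "restr g $ i $ j = vco (g *v vemb (axis j 1)) $ i" for g
    by (simp add: restr_def matrix_def)
  moreover have "(\<lambda>g. vco (g *v vemb (axis j 1)) $ i) \<in> regular_functions \<real>"
    using exhaust_3[of i] real_w real by (auto intro: regular_coordinate)
  ultimately show ?thesis by (intro bexI[rotated]) auto
qed

lemma regular_lift: "\<exists>f\<in>regular_functions \<real>. \<forall>h\<in>SL3. lift h $ i $ j = f h"
proof -
  have a: "axis j 1 \<in> real_points" by (simp add: real_points_def axis_def)
  have real: "u $ i \<in> \<real>" if "u \<in> real_points" for u :: "complex^8" and i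
    using that by (simp add: real_points_def)
  have "(\<lambda>h. lift h $ i $ j) \<in> regular_functions \<real>"
    unfolding lift_def matrix_def
    using a real_frame real_w
    by (simp add: act_def zorn_def vemb_def wemb_def matrix_vector_mult_def sum_3)
      (intro regular_functions.add regular_functions.mult regular_diff regular_functions.entry
        regular_functions.const Reals_mult Reals_minus Reals_1 Reals_numeral real real_B; assumption)
  then show ?thesis by (intro bexI[rotated]) auto
qed

theorem stab_iso_SL3: "algebraic_iso \<real> stab SL3"
  unfolding algebraic_iso_def
proof (intro exI conjI)
  show "algebraic_hom \<real> stab SL3 restr"
    unfolding algebraic_hom_def hom_def matrix_group_def
    using regular_restr by (simp add: stab_structure(1) restr_mult)
  show "algebraic_hom \<real> SL3 stab lift"
    unfolding algebraic_hom_def hom_def matrix_group_def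
    using regular_lift by (simp add: lift_in_stab lift_mult)
qed (simp_all add: lift_restr restr_lift)

end

section \<open>Octonion algebras at a real place\<close>

lemma real_points_iff: "u \<in> real_points \<longleftrightarrow> (\<exists>r. u = ext_vec complex_of_real r)"
proof
  assume "u \<in> real_points"
  then have "u = ext_vec complex_of_real (\<chi> i. Re (u $ i))"
    by (simp add: real_points_def ext_vec_def vec_eq_iff)
  then show "\<exists>r. u = ext_vec complex_of_real r" ..
qed (auto simp: real_points_def ext_vec_def)

context real_octonion
begin

text \<open>With \<open>s\<^sup>2 = - N(x)\<close> the elements \<open>(e \<plusminus> x/s)/2\<close> are real isotropic idempotents with sum \<open>e\<close>. A
  frame found over \<open>\<real>\<close> remains a frame over \<open>\<complex>\<close>, so that the isomorphism obtained over \<open>\<complex>\<close> is defined over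
  \<open>\<real>\<close>.\<close>

theorem stabilizer_iso_SL3:
  assumes "N x < 0"
  shows "algebraic_iso \<real>
    {g \<in> aut_group (ext_mult complex_of_real m). g *v ext_vec complex_of_real x = ext_vec complex_of_real x} SL3"
proof -
  define s where "s = sqrt (- N x)"
  have s: "s > 0" "s * s = - N x" using assms by (simp_all add: s_def)
  define p where "p = (1/2) *s e + (1 / (2 * s)) *s x"
  define q where "q = (1/2) *s e - (1 / (2 * s)) *s x"
  have "p + q = e" by (simp add: p_def q_def vec_eq_iff)
  moreover have "N p = 0" "N q = 0"
  proof -
    have norm: "N ((1/2) *s e + c *s x) = 1/4 - (c * s)\<^sup>2" for c
    proof -
      have "N x = - (s\<^sup>2)" using s(2) by (simp add: power2_eq_square)
      then show ?thesis
        by (simp add: N_add N_scale N_unit B_linear x_pure' power_mult_distrib power_divide)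
    qed
    have "q = (1/2) *s e + (- (1 / (2 * s))) *s x" by (simp add: q_def)
    then show "N p = 0" "N q = 0"
      using s(1) by (simp_all only: p_def norm) (simp_all add: power2_eq_square)
  qed
  ultimately interpret peirce m e N p q by unfold_locales
  obtain v1 v2 v3 where v: "v1 \<in> V" "v2 \<in> V" "v3 \<in> V" "2 * B (m v1 v2) v3 = 1"
    by (rule V_triple_exists)
  let ?c = "ext_vec complex_of_real"
  interpret E: octonion_extension m e N complex_of_real
    by (intro octonion_extension.intro field_embedding_of_real octonion_axioms)
  interpret C: octonion E.m' E.e' E.N' by (rule E.octonion_ext)
  have mem: "?c v \<in> peirce_space E.m' E.N' (?c p) (?c q)" if "v \<in> V" for v
    using that by (simp add: peirce_space_def E.ext_B_ext_vec E.ext_mult_ext_vec)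
  interpret C: real_zorn_frame E.m' E.e' E.N' "?c p" "?c q" "?c v1" "?c v2" "?c v3"
  proof unfold_locales
    show "?c p + ?c q = ?c e" by (simp add: sum_unit flip: E.ext_vec_add)
    show "E.N' (?c p) = 0" "E.N' (?c q) = 0" by (simp_all add: E.ext_N_ext_vec isotropic_p isotropic_q)
    show "2 * C.B (E.m' (?c v1) (?c v2)) (?c v3) = 1"
      using arg_cong[OF v(4), of complex_of_real] by (simp add: E.ext_mult_ext_vec E.ext_B_ext_vec)
  qed (use v mem in \<open>auto simp: real_points_iff E.ext_mult_ext_vec E.ext_B_ext_vec\<close>)
  have x_eq: "?c x = complex_of_real s *s (?c p - ?c q)"
  proof -
    have "x = s *s (p - q)" using s(1) by (simp add: p_def q_def vec_eq_iff)
    then have "?c x = ?c (s *s (p - q))" by (simp only:)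
    then show ?thesis by (simp only: E.ext_vec_scale E.ext_vec_diff)
  qed
  have "g *v ?c x = ?c x \<longleftrightarrow> g *v (?c p - ?c q) = ?c p - ?c q" for g
    using s(1) unfolding x_eq vector_scalar_commute vec.scale_cancel_left by simp
  then show ?thesis using C.stab_iso_SL3 by (simp add: C.stab_def)
qed

end

theorem corollary5p3:
  fixes m :: "'k::field_char_0^8 \<Rightarrow> 'k^8 \<Rightarrow> 'k^8" and e :: "'k^8" and N :: "'k^8 \<Rightarrow> 'k"
    and \<nu> :: "'k \<Rightarrow> real"
    and G H :: "(complex^8^8) set" and x :: "'k^8" and A :: "('k^8) set"
    and \<iota> :: "'k \<Rightarrow> complex"
    and m\<^sub>\<nu> :: "real^8 \<Rightarrow> real^8 \<Rightarrow> real^8" and e\<^sub>\<nu> :: "real^8" and N\<^sub>\<nu> :: "real^8 \<Rightarrow> real"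
    and x\<^sub>\<nu> :: "real^8" and A\<^sub>\<nu> :: "(real^8) set"
    and Herm\<^sub>\<nu> :: "real^8 \<Rightarrow> real^8 \<Rightarrow> real^8"
  assumes k: "number_field_or_completion TYPE('k)"
    and O: "octonion_algebra m e N"
    and \<nu>: "real_place \<nu>"
    and \<iota>: "\<iota> = complex_of_real \<circ> \<nu>"
    and G: "G = aut_group (ext_mult \<iota> m)"
    and H: "simply_connected_A2_subgroup (range \<iota>) G H"
    and x: "bform N x e = 0" "N x \<noteq> 0" "H = {g \<in> G. g *v ext_vec \<iota> x = ext_vec \<iota> x}"
    and A: "A = generated_subalgebra m e {x}"
    and ext\<^sub>\<nu>: "m\<^sub>\<nu> = ext_mult \<nu> m" "e\<^sub>\<nu> = ext_vec \<nu> e" "N\<^sub>\<nu> = ext_form \<nu> N"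
              "x\<^sub>\<nu> = ext_vec \<nu> x" "A\<^sub>\<nu> = ext_space \<nu> A"
    and Herm\<^sub>\<nu>: "Herm\<^sub>\<nu> = herm_form m\<^sub>\<nu> e\<^sub>\<nu> N\<^sub>\<nu> x\<^sub>\<nu>"
  shows "(definite_form N\<^sub>\<nu> \<longrightarrow>
            imaginary_algebra m\<^sub>\<nu> e\<^sub>\<nu> A\<^sub>\<nu> \<and>
            definite_hermitian e\<^sub>\<nu> (ortho_compl N\<^sub>\<nu> A\<^sub>\<nu>) Herm\<^sub>\<nu>) \<and>
         (indefinite_form N\<^sub>\<nu> \<and> imaginary_algebra m\<^sub>\<nu> e\<^sub>\<nu> A\<^sub>\<nu> \<longrightarrow>
            indefinite_hermitian e\<^sub>\<nu> (ortho_compl N\<^sub>\<nu> A\<^sub>\<nu>) Herm\<^sub>\<nu>) \<and>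
         (indefinite_form N\<^sub>\<nu> \<and> real_split_algebra m\<^sub>\<nu> e\<^sub>\<nu> A\<^sub>\<nu> \<longrightarrow>
            algebraic_iso \<real> H SL3)"
proof -
  interpret k: octonion m e N by unfold_locales (rule O)
  interpret E: octonion_extension m e N \<nu>
    by (intro octonion_extension.intro field_embedding_real_place \<nu> k.octonion_axioms)
  interpret octonion m\<^sub>\<nu> e\<^sub>\<nu> N\<^sub>\<nu> unfolding ext\<^sub>\<nu> by (rule E.octonion_ext)
  interpret real_octonion m\<^sub>\<nu> e\<^sub>\<nu> N\<^sub>\<nu> x\<^sub>\<nu>
    by unfold_locales (simp_all add: ext\<^sub>\<nu> E.ext_B_ext_vec E.ext_N_ext_vec x(1,2))
  (* Extension of scalars commutes with the formation of the subalgebra generated by x. *)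
  have A\<^sub>\<nu>: "A\<^sub>\<nu> = vec.span {e\<^sub>\<nu>, x\<^sub>\<nu>}"
  proof -
    have A_span: "A = vec.span {e, x}" unfolding A by (rule k.generated_subalgebra_pure) (rule x(1))
    have "ext_vec \<nu> ` A \<subseteq> vec.span {e\<^sub>\<nu>, x\<^sub>\<nu>}"
    proof
      fix y assume "y \<in> ext_vec \<nu> ` A"
      then obtain \<alpha> \<beta> where "y = ext_vec \<nu> (\<alpha> *s e + \<beta> *s x)"
        unfolding A_span image_iff Bex_def k.in_span_pure_iff by (elim exE conjE) simp
      then have "y = \<nu> \<alpha> *s e\<^sub>\<nu> + \<nu> \<beta> *s x\<^sub>\<nu>"
        by (simp add: E.ext_vec_add E.ext_vec_scale ext\<^sub>\<nu>)
      then show "y \<in> vec.span {e\<^sub>\<nu>, x\<^sub>\<nu>}" unfolding in_span_pure_iff by (intro exI)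
    qed
    then have "A\<^sub>\<nu> \<subseteq> vec.span {e\<^sub>\<nu>, x\<^sub>\<nu>}"
      unfolding ext\<^sub>\<nu>(5) ext_space_def by (rule vec.span_minimal) (rule vec.subspace_span)
    moreover have "{e\<^sub>\<nu>, x\<^sub>\<nu>} \<subseteq> ext_vec \<nu> ` A"
      unfolding A_span by (auto simp: ext\<^sub>\<nu> intro: vec.span_base)
    then have "vec.span {e\<^sub>\<nu>, x\<^sub>\<nu>} \<subseteq> A\<^sub>\<nu>"
      unfolding ext\<^sub>\<nu>(5) ext_space_def by (rule vec.span_mono)
    ultimately show ?thesis by (rule antisym)
  qed
  have "ext_mult complex_of_real m\<^sub>\<nu> = ext_mult \<iota> m"
    unfolding ext\<^sub>\<nu> \<iota> by (intro ext_mult_comp field_embedding_real_place \<nu> field_embedding_of_real)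
  moreover have "ext_vec complex_of_real x\<^sub>\<nu> = ext_vec \<iota> x"
    by (simp add: ext\<^sub>\<nu> \<iota> ext_vec_def)
  ultimately have H_eq: "H = {g \<in> aut_group (ext_mult complex_of_real m\<^sub>\<nu>).
      g *v ext_vec complex_of_real x\<^sub>\<nu> = ext_vec complex_of_real x\<^sub>\<nu>}"
    using x(3) G by simp
  have x_nonzero: "x\<^sub>\<nu> \<noteq> 0" using x_anisotropic N_scale[of 0 x\<^sub>\<nu>] by auto
  show ?thesis
    unfolding A\<^sub>\<nu> Herm\<^sub>\<nu> H_eq
    using imaginary_algebra_if_pos definite_form_pos x_nonzero definite_hermitian_if_definite
      pos_if_imaginary_algebra indefinite_hermitian_if_indefinite
      neg_if_real_split_algebra stabilizer_iso_SL3
    by (intro conjI impI) simp_all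
qed

end
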